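(* Let $z\in\mathbb{C}$ with $-1<\operatorname{Re}(z)<1$ and $x>0$. Then \[ H_z^{(1)}(x)=\frac{\pi}{2}x^{-z/2}\Big(\cos\big(\tfrac12\pi z\big)M_z(2\sqrt{x})-\sin\big(\tfrac12\pi z\big)J_z(2\sqrt{x})\Big), \] where $M_\nu(x)=\frac{2}{\pi}K_\nu(x)-Y_\nu(x)$.
   Context: $H_z^{(1)}(x):=\int_0^\infty t^{z-1}\cos(xt)\cos(1/t)\,dt$. $J_\nu$, $Y_\nu$, $K_\nu$ are the standard Bessel function of the first kind, Bessel function of the second kind, and modified Bessel function of the second kind. *)

theory Defs
  imports "HOL-Analysis.Analysis"
begin

section \<open>Bessel functions of complex order\<close>

text \<open>
  The factor \<open>(w / 2) powr \<nu>\<close> is the principal branch. Since \<open>0 powr \<nu> = 0\<close>, the definitions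
  carry their usual meaning only for \<open>w \<noteq> 0\<close>. The total function \<open>rGamma\<close> is the entire function
  \<open>1 / \<Gamma>\<close>, so terms at poles of the Gamma function vanish, as they should.
\<close>

definition bessel_J :: "complex \<Rightarrow> complex \<Rightarrow> complex" where
  "bessel_J \<nu> w =
     (w / 2) powr \<nu> * (\<Sum>k. (-1) ^ k * rGamma (\<nu> + of_nat k + 1) / fact k * (w / 2) ^ (2 * k))"

definition bessel_I :: "complex \<Rightarrow> complex \<Rightarrow> complex" where
  "bessel_I \<nu> w =
     (w / 2) powr \<nu> * (\<Sum>k. rGamma (\<nu> + of_nat k + 1) / fact k * (w / 2) ^ (2 * k))"

text \<open>At integer order, the second-kind functions are the limits in the order of the quotients
  that define them at non-integer order.\<close>

definition bessel_Y :: "complex \<Rightarrow> complex \<Rightarrow> complex" where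
  "bessel_Y \<nu> w =
     (let Q = (\<lambda>\<mu>. (bessel_J \<mu> w * cos (of_real pi * \<mu>) - bessel_J (- \<mu>) w) / sin (of_real pi * \<mu>))
      in if \<nu> \<in> \<int> then Lim (at \<nu>) Q else Q \<nu>)"

definition bessel_K :: "complex \<Rightarrow> complex \<Rightarrow> complex" where
  "bessel_K \<nu> w =
     (let Q = (\<lambda>\<mu>. of_real pi / 2 * (bessel_I (- \<mu>) w - bessel_I \<mu> w) / sin (of_real pi * \<mu>))
      in if \<nu> \<in> \<int> then Lim (at \<nu>) Q else Q \<nu>)"

definition bessel_M :: "complex \<Rightarrow> complex \<Rightarrow> complex" where
  "bessel_M \<nu> w = 2 / of_real pi * bessel_K \<nu> w - bessel_Y \<nu> w"


section \<open>The integral \<open>H\<close>\<close>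

text \<open>
  For \<open>\<bar>Re z\<bar> < 1\<close> the defining integral is never absolutely convergent (it fails at infinity
  if \<open>Re z \<ge> 0\<close> and at zero if \<open>Re z \<le> 0\<close>), so it is read as an improper Riemann
  integral with independent limits at both ends of \<open>(0, \<infinity>)\<close>.
\<close>

definition has_improper_integral_pos :: "(real \<Rightarrow> complex) \<Rightarrow> complex \<Rightarrow> bool" where
  "has_improper_integral_pos f L \<longleftrightarrow>
     (\<forall>a b. 0 < a \<longrightarrow> a \<le> b \<longrightarrow> f integrable_on {a..b}) \<and>
     ((\<lambda>(a, b). integral {a..b} f) \<longlongrightarrow> L) (at_right 0 \<times>\<^sub>F at_top)"

definition H1_integrand :: "complex \<Rightarrow> real \<Rightarrow> real \<Rightarrow> complex" where
  "H1_integrand z x t = of_real t powr (z - 1) * of_real (cos (x * t)) * of_real (cos (1 / t))"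

definition H1 :: "complex \<Rightarrow> real \<Rightarrow> complex" where
  "H1 z x = (THE L. has_improper_integral_pos (H1_integrand z x) L)"

end

theory Submission
  imports Defs "HOL-Complex_Analysis.Complex_Analysis" "HOL-Real_Asymp.Real_Asymp"
begin

text \<open>
  Split the integral at \<open>t = 1\<close>; the substitution \<open>t \<mapsto> 1 / t\<close> turns the part over \<open>(0, 1)\<close> into one over
  \<open>(1, \<infinity>)\<close> with \<open>z\<close> replaced by \<open>- z\<close> and the frequencies exchanged. On \<open>(1, \<infinity>)\<close> expand
  \<open>cos (y / t)\<close> into its power series and use, for \<open>Re s < 1\<close>,
  \<open>\<integral>\<^sub>1\<^sup>\<infinity> t powr (s - 1) cos (x t) dt = \<Gamma>(s) cos (\<pi> s / 2) x powr (- s) - \<Sum>\<^sub>m (-1)^m x^(2m) / ((2m)! (s + 2m))\<close>.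
  The resulting double sums over \<open>1 / (z - 2k + 2m)\<close> from the two halves cancel, and the reflection
  formula turns the Gamma terms into the even parts of the Bessel series of order \<open>\<plusminus> z\<close>.
  This covers \<open>z \<noteq> 0\<close>. At \<open>z = 0\<close> both sides are limits: the integral converges uniformly in \<open>z\<close>
  near \<open>0\<close>, and the quotients defining the Bessel functions of the second kind have removable singularities.
\<close>

section \<open>The lower incomplete Gamma function\<close>

text \<open>This is \<open>w powr (- s)\<close> times the lower incomplete Gamma function of (s, w),
  read off from the power series of exp(-w). Without the power factor it is entire in
  \<open>w\<close>, so evaluating it at imaginary arguments raises no branch question.\<close>

definition lower_gamma_series :: "complex \<Rightarrow> complex \<Rightarrow> complex" where
  "lower_gamma_series s w = (\<Sum>n. (-1) ^ n / (fact n * (s + of_nat n)) * w ^ n)"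

lemma summable_lower_gamma_series:
  "summable (\<lambda>n. (-1) ^ n / (fact n * (s + of_nat n)) * w ^ n :: complex)"
proof (rule summable_comparison_test_ev)
  show "summable (\<lambda>n. norm w ^ n / fact n)"
    using summable_norm_exp[of w] by (simp add: norm_divide norm_power divide_inverse mult.commute)
  show "eventually (\<lambda>n. norm ((-1) ^ n / (fact n * (s + of_nat n)) * w ^ n) \<le> norm w ^ n / fact n)
          sequentially"
    \<comment> \<open>From this index on, |s + n| \<ge> n - |s| \<ge> 1, so the denominators are at
      least n! in modulus.\<close>
    using eventually_ge_at_top[of "nat \<lceil>1 + norm s\<rceil>"]
  proof eventually_elim
    case (elim n)
    then have "1 \<le> real n - norm s" by linarith
    also have "\<dots> \<le> norm (s + of_nat n)"
      using norm_diff_ineq[of "of_nat n :: complex" s] by (simp add: add.commute)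
    finally have "1 \<le> norm (s + of_nat n)" .
    then have "fact n * 1 \<le> fact n * norm (s + of_nat n)"
      by (intro mult_left_mono) auto
    then have "norm w ^ n / (fact n * norm (s + of_nat n)) \<le> norm w ^ n / (fact n * 1)"
      by (intro divide_left_mono mult_pos_pos) (use \<open>1 \<le> norm (s + of_nat n)\<close> in \<open>auto intro: order.strict_trans1\<close>)
    then show ?case
      by (simp add: norm_mult norm_divide norm_power)
  qed
qed

lemma lower_gamma_series_sums:
  "(\<lambda>n. (-1) ^ n / (fact n * (s + of_nat n)) * w ^ n) sums lower_gamma_series s w"
  unfolding lower_gamma_series_def by (intro summable_sums summable_lower_gamma_series)

lemma exp_minus_sums: "(\<lambda>n. (-1) ^ n / fact n * w ^ n) sums exp (- w :: complex)"
proof -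
  have "(- w) ^ n /\<^sub>R fact n = (-1) ^ n / fact n * w ^ n" for n
    by (subst power_minus) (simp add: scaleR_conv_of_real field_simps)
  then show ?thesis
    using exp_converges[of "- w"] by simp
qed

text \<open>Multiplying the n-th coefficient by s + n leaves (-1)^n / n!. The resulting differential
  equation is the branch-free form of the statement that w^s times the series is a primitive of
  w^(s-1) exp(-w).\<close>

lemma has_field_derivative_lower_gamma_series:
  assumes "s \<notin> \<int>\<^sub>\<le>\<^sub>0"
  obtains D where "(lower_gamma_series s has_field_derivative D) (at w)"
    and "s * lower_gamma_series s w + w * D = exp (- w)"
proof
  define c :: "nat \<Rightarrow> complex" where "c = (\<lambda>n. (-1) ^ n / (fact n * (s + of_nat n)))"
  have g: "lower_gamma_series s = (\<lambda>w. \<Sum>n. c n * w ^ n)"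
    by (auto simp: lower_gamma_series_def c_def)
  have sm: "summable (\<lambda>n. c n * y ^ n)" for y
    unfolding c_def by (rule summable_lower_gamma_series)
  let ?D = "\<Sum>n. diffs c n * w ^ n"
  show "(lower_gamma_series s has_field_derivative ?D) (at w)"
    unfolding g by (rule termdiffs_strong_converges_everywhere[OF sm])
  have "(\<lambda>n. diffs c n * w ^ n) sums ?D"
    by (intro summable_sums termdiff_converges_all sm)
  then have "(\<lambda>n. w * (diffs c n * w ^ n)) sums (w * ?D)"
    by (rule sums_mult)
  then have "(\<lambda>n. of_nat (Suc n) * c (Suc n) * w ^ Suc n) sums (w * ?D)"
    by (simp add: diffs_def mult_ac)
  then have "(\<lambda>n. of_nat n * c n * w ^ n) sums (w * ?D)"
    by (subst (asm) sums_Suc_iff) simp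
  then have "(\<lambda>n. s * (c n * w ^ n) + of_nat n * c n * w ^ n)
               sums (s * lower_gamma_series s w + w * ?D)"
    unfolding g by (intro sums_add sums_mult summable_sums sm)
  moreover have "s * (c n * w ^ n) + of_nat n * c n * w ^ n = (-1) ^ n / fact n * w ^ n" for n
  proof -
    have "s + of_nat n \<noteq> 0"
      using assms by (metis add_eq_0_iff2 minus_of_nat_in_nonpos_Ints)
    have "s * (c n * w ^ n) + of_nat n * c n * w ^ n = (s + of_nat n) * c n * w ^ n"
      by (simp add: algebra_simps)
    also have "\<dots> = (-1) ^ n / fact n * w ^ n"
      using \<open>s + of_nat n \<noteq> 0\<close> by (simp add: c_def)
    finally show ?thesis .
  qed
  ultimately show "s * lower_gamma_series s w + w * ?D = exp (- w)"
    using exp_minus_sums[of w] by (simp add: sums_unique2)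
qed

text \<open>The derivative of the series is minus the series at \<open>s + 1\<close>, which turns
  the differential equation into a recurrence. It plays the part of the functional equation of Gamma
  and carries limits to Re s \<le> 0.\<close>

lemma lower_gamma_series_plus1:
  assumes "s \<notin> \<int>\<^sub>\<le>\<^sub>0"
  shows "s * lower_gamma_series s w = exp (- w) + w * lower_gamma_series (s + 1) w"
proof -
  have "(\<lambda>n. - (w * ((-1) ^ n / (fact n * (s + 1 + of_nat n)) * w ^ n)))
          sums (- (w * lower_gamma_series (s + 1) w))"
    by (intro sums_minus sums_mult lower_gamma_series_sums)
  moreover have "- (w * ((-1) ^ n / (fact n * (s + 1 + of_nat n)) * w ^ n)) =
          of_nat (Suc n) * ((-1) ^ Suc n / (fact (Suc n) * (s + of_nat (Suc n))) * w ^ Suc n)" for n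
  proof -
    have "- (w * (a / (f * B) * p)) = A * (- a / (A * f * B) * (w * p))"
      if "A \<noteq> 0" for a f B p A :: complex
      using that by (cases "B = 0"; cases "f = 0") (simp_all add: field_simps)
    from this[of "of_nat (Suc n)" "(-1) ^ n" "fact n" "s + 1 + of_nat n" "w ^ n"] show ?thesis
      by (simp add: algebra_simps del: of_nat_Suc) (simp add: algebra_simps)
  qed
  ultimately have "(\<lambda>n. of_nat (Suc n) * ((-1) ^ Suc n / (fact (Suc n) * (s + of_nat (Suc n))) * w ^ Suc n))
        sums (- (w * lower_gamma_series (s + 1) w))"
    by simp
  then have "(\<lambda>n. of_nat n * ((-1) ^ n / (fact n * (s + of_nat n)) * w ^ n))
        sums (- (w * lower_gamma_series (s + 1) w))"
    by (subst (asm) sums_Suc_iff) simp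
  from sums_add[OF sums_mult[OF lower_gamma_series_sums[of s w], of s] this]
  have "(\<lambda>n. s * ((-1) ^ n / (fact n * (s + of_nat n)) * w ^ n) +
           of_nat n * ((-1) ^ n / (fact n * (s + of_nat n)) * w ^ n))
        sums (s * lower_gamma_series s w - w * lower_gamma_series (s + 1) w)"
    by simp
  moreover have "s * ((-1) ^ n / (fact n * (s + of_nat n)) * w ^ n) +
           of_nat n * ((-1) ^ n / (fact n * (s + of_nat n)) * w ^ n) = (-1) ^ n / fact n * w ^ n" for n
  proof -
    have "s + of_nat n \<noteq> 0"
      using assms by (metis add_eq_0_iff2 minus_of_nat_in_nonpos_Ints)
    then show ?thesis
      by (simp add: divide_simps) (simp add: algebra_simps)
  qed
  ultimately have "s * lower_gamma_series s w - w * lower_gamma_series (s + 1) w = exp (- w)"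
    using exp_minus_sums[of w] by (simp add: sums_unique2)
  then show ?thesis by (simp add: algebra_simps)
qed

section \<open>Primitives on the half line and the limit along the positive real axis\<close>

lemma powr_of_real_has_vector_derivative:
  assumes "t > 0"
  shows "((\<lambda>t. of_real t powr s :: complex) has_vector_derivative s * of_real t powr (s - 1)) (at t within A)"
proof (rule has_vector_derivative_real_field)
  show "((\<lambda>t. t powr s) has_field_derivative s * of_real t powr (s - 1)) (at (of_real t))"
    using assms by (auto intro!: derivative_eq_intros simp: complex_nonpos_Reals_iff)
qed

text \<open>The free factor \<open>w\<close> covers both uses: \<open>w = 1\<close> for the Euler
  integral, and purely imaginary \<open>w\<close> for the oscillating integrals.\<close>

lemma powr_lower_gamma_series_has_vector_derivative:
  assumes "s \<notin> \<int>\<^sub>\<le>\<^sub>0" "t > 0"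
  shows "((\<lambda>t. of_real t powr s * lower_gamma_series s (of_real t * w)) has_vector_derivative
            of_real t powr (s - 1) * exp (- (of_real t * w))) (at t within A)"
proof -
  obtain D where D: "(lower_gamma_series s has_field_derivative D) (at (of_real t * w))"
    and eq: "s * lower_gamma_series s (of_real t * w) + of_real t * w * D = exp (- (of_real t * w))"
    using has_field_derivative_lower_gamma_series[OF assms(1)] by blast
  have "((\<lambda>t. of_real t * w) has_vector_derivative w) (at t within A)"
    by (auto intro!: derivative_eq_intros)
  from field_vector_diff_chain_within[OF this has_field_derivative_at_within[OF D]]
  have "((\<lambda>t. lower_gamma_series s (of_real t * w)) has_vector_derivative (w * D)) (at t within A)"
    by (simp add: o_def)
  from has_vector_derivative_mult[OF powr_of_real_has_vector_derivative[OF assms(2)] this]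
  have "((\<lambda>t. of_real t powr s * lower_gamma_series s (of_real t * w)) has_vector_derivative
      (of_real t powr s * (w * D) + s * of_real t powr (s - 1) * lower_gamma_series s (of_real t * w)))
         (at t within A)" .
  moreover have "of_real t powr s = of_real t * (of_real t powr (s - 1) :: complex)"
    using assms by (simp add: powr_diff)
  ultimately show ?thesis
    unfolding eq[symmetric] by (simp add: algebra_simps)
qed

lemma continuous_on_lower_gamma_series:
  assumes "s \<notin> \<int>\<^sub>\<le>\<^sub>0"
  shows "continuous_on A (lower_gamma_series s)"
  using has_field_derivative_lower_gamma_series[OF assms]
  by (meson DERIV_isCont continuous_at_imp_continuous_on)

lemma tendsto_lower_gamma_series_real_Re_pos:
  assumes "Re s > 0"
  shows "((\<lambda>R. of_real R powr s * lower_gamma_series s (of_real R)) \<longlongrightarrow> Gamma s) at_top"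
proof -
  define f :: "real \<Rightarrow> complex" where "f = (\<lambda>t. of_real t powr (s - 1) / of_real (exp t))"
  have s: "s \<notin> \<int>\<^sub>\<le>\<^sub>0"
    using assms by (auto elim!: nonpos_Ints_cases)
  have "f absolutely_integrable_on {0<..}"
    unfolding f_def by (rule absolutely_integrable_Gamma_integral'[OF assms])
  \<comment> \<open>Adding the endpoint is harmless because \<open>0 powr (s - 1) = 0\<close>, so
    \<open>f 0 = 0\<close>.\<close>
  then have abs: "f absolutely_integrable_on {0..}"
    unfolding set_integrable_def
    by (rule back_subst[of "integrable lebesgue"]) (auto simp: f_def indicator_def fun_eq_iff)
  have "((\<lambda>b. set_lebesgue_integral lebesgue {0..b} f) \<longlongrightarrow> set_lebesgue_integral lebesgue {0..} f) at_top"
    by (rule tendsto_set_lebesgue_integral_at_top) (use abs in auto)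
  moreover have "set_lebesgue_integral lebesgue {0..} f = Gamma s"
    using abs Gamma_integral_complex[OF assms]
    by (simp add: set_lebesgue_integral_eq_integral f_def integral_unique)
  moreover have "set_lebesgue_integral lebesgue {0..b} f = of_real b powr s * lower_gamma_series s (of_real b)"
    if "b > 0" for b
  proof -
    have "f absolutely_integrable_on {0..b}"
      using abs by (rule set_integrable_subset) auto
    then have "set_lebesgue_integral lebesgue {0..b} f = integral {0..b} f"
      by (rule set_lebesgue_integral_eq_integral)
    \<comment> \<open>The lower boundary term is 0, and Re s > 0 makes the primitive continuous at
      0.\<close>
    moreover have "(f has_integral of_real b powr s * lower_gamma_series s (of_real b * 1) -
                      of_real 0 powr s * lower_gamma_series s (of_real 0 * 1)) {0..b}"
    proof (rule fundamental_theorem_of_calculus_interior)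
      show "continuous_on {0..b} (\<lambda>b. of_real b powr s * lower_gamma_series s (of_real b * 1))"
        using assms
        by (intro continuous_intros continuous_on_compose2[OF continuous_on_lower_gamma_series[OF s, of UNIV]]) auto
      show "((\<lambda>b. of_real b powr s * lower_gamma_series s (of_real b * 1)) has_vector_derivative f t) (at t)"
        if "t \<in> {0<..<b}" for t
        using powr_lower_gamma_series_has_vector_derivative[OF s, of t 1 UNIV] that
        by (simp add: f_def exp_minus field_simps exp_of_real)
    qed (use that in auto)
    ultimately show ?thesis by (simp add: integral_unique)
  qed
  moreover have "\<forall>\<^sub>F b in at_top. set_lebesgue_integral lebesgue {0..b} f =
                   of_real b powr s * lower_gamma_series s (of_real b)"
    using eventually_gt_at_top[of 0] by eventually_elim fact
  ultimately show ?thesis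
    by (simp add: Lim_transform_eventually)
qed

lemma powr_times_exp_minus_tendsto_0:
  "((\<lambda>R. of_real R powr s * exp (- of_real R) :: complex) \<longlongrightarrow> 0) at_top"
proof (rule tendsto_norm_zero_cancel)
  have "((\<lambda>R::real. R powr Re s * exp (- R)) \<longlongrightarrow> 0) at_top"
    by real_asymp
  moreover have "\<forall>\<^sub>F R in at_top. R powr Re s * exp (- R) = norm (of_real R powr s * exp (- of_real R) :: complex)"
    using eventually_gt_at_top[of 0]
    by eventually_elim (simp add: norm_mult norm_powr_real_powr)
  ultimately show "((\<lambda>R. norm (of_real R powr s * exp (- of_real R) :: complex)) \<longlongrightarrow> 0) at_top"
    by (rule Lim_transform_eventually)
qed

text \<open>Gamma is continued strip by strip: dividing the recurrence by \<open>s\<close> extends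
  the claim from Re s > -n to Re s > -(n+1), and the extra term with exp(-R) vanishes in the
  limit.\<close>

lemma tendsto_lower_gamma_series_real:
  assumes "s \<notin> \<int>\<^sub>\<le>\<^sub>0"
  shows "((\<lambda>R. of_real R powr s * lower_gamma_series s (of_real R)) \<longlongrightarrow> Gamma s) at_top"
proof -
  have "((\<lambda>R. of_real R powr s * lower_gamma_series s (of_real R)) \<longlongrightarrow> Gamma s) at_top"
    if "Re s > - real n" "s \<notin> \<int>\<^sub>\<le>\<^sub>0" for n
    using that
  proof (induction n arbitrary: s)
    case 0
    then show ?case by (simp add: tendsto_lower_gamma_series_real_Re_pos)
  next
    case (Suc n)
    have s1: "s + 1 \<notin> \<int>\<^sub>\<le>\<^sub>0"
      using Suc.prems plus_one_in_nonpos_Ints_imp by blast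
    have "s \<noteq> 0" using Suc.prems by auto
    have ih: "((\<lambda>R. of_real R powr (s + 1) * lower_gamma_series (s + 1) (of_real R)) \<longlongrightarrow> Gamma (s + 1)) at_top"
      by (rule Suc.IH) (use Suc.prems s1 in auto)
    have "((\<lambda>R. (of_real R powr s * exp (- of_real R) +
             of_real R powr (s + 1) * lower_gamma_series (s + 1) (of_real R)) / s)
             \<longlongrightarrow> (0 + Gamma (s + 1)) / s) at_top"
      by (intro tendsto_intros ih powr_times_exp_minus_tendsto_0 \<open>s \<noteq> 0\<close>)
    moreover have "(0 + Gamma (s + 1)) / s = Gamma s"
      using Suc.prems \<open>s \<noteq> 0\<close> by (simp add: Gamma_plus1)
    moreover have "\<forall>\<^sub>F R in at_top. (of_real R powr s * exp (- of_real R) +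
             of_real R powr (s + 1) * lower_gamma_series (s + 1) (of_real R)) / s =
             of_real R powr s * lower_gamma_series s (of_real R)"
      using eventually_gt_at_top[of 0]
    proof eventually_elim
      case (elim R)
      have "of_real R powr s * (s * lower_gamma_series s (of_real R)) =
            of_real R powr s * exp (- of_real R) +
             of_real R powr (s + 1) * lower_gamma_series (s + 1) (of_real R)"
        using elim by (subst lower_gamma_series_plus1[OF Suc.prems(2)]) (simp add: powr_add algebra_simps)
      then show ?case using \<open>s \<noteq> 0\<close> by (simp add: field_simps)
    qed
    ultimately show ?case
      by (simp add: Lim_transform_eventually)
  qed
  moreover have "Re s > - real (nat \<lceil>1 - Re s\<rceil>)" by linarith
  ultimately show ?thesis using assms by blast
qed

section \<open>Rotation from the real to the imaginary axis\<close>

text \<open>A weak form of Jordan's inequality. Up to pi/3 the mean value theorem applies with cos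
  \<ge> 1/2; beyond that, sin u \<ge> sqrt 3 / 2 \<ge> 0.85 while u / 2 \<le> 0.8.\<close>

lemma sin_ge_half:
  fixes u :: real
  assumes "0 \<le> u" "u \<le> pi / 2"
  shows "u / 2 \<le> sin u"
proof (cases "u \<le> pi / 3")
  case True
  show ?thesis
  proof (cases "u = 0")
    case False
    with assms have "u > 0" by simp
    then obtain v where v: "0 < v" "v < u" "sin u - sin 0 = (u - 0) * cos v"
      using MVT2[of 0 u sin cos] by (auto intro: DERIV_sin)
    have "cos (pi / 3) \<le> cos v"
      using v True by (intro cos_monotone_0_pi_le) auto
    then have "u * (1 / 2) \<le> u * cos v"
      using \<open>u > 0\<close> by (intro mult_left_mono) (auto simp: cos_60)
    with v show ?thesis by simp
  qed auto
next
  case False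
  have "sin (pi / 3) \<le> sin u"
    using False assms pi_gt_zero by (intro sin_monotone_2pi_le) linarith+
  moreover have "sqrt 3 \<ge> 1.7" by (rule real_le_rsqrt) (simp add: power2_eq_square)
  moreover have "u \<le> 1.6" using assms pi_approx by simp
  ultimately show ?thesis by (simp add: sin_60)
qed

text \<open>
  Compares the primitive \<open>w powr s * lower_gamma_series s w\<close> of \<open>w powr (s - 1) * exp (- w)\<close>, up to the
  constant factor \<open>R powr s\<close>, at the two ends of the arc from \<open>R\<close> to \<open>\<plusminus> \<i> R\<close>. As in Jordan's lemma, the
  length of the arc is compensated by the decay of \<open>exp (- R cos t)\<close>. The sign is carried by \<open>e\<close>.
\<close>

lemma lower_gamma_series_arc_bound:
  fixes R e :: real
  assumes s: "s \<notin> \<int>\<^sub>\<le>\<^sub>0" and R: "R > 0" and e: "\<bar>e\<bar> = 1"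
  shows "norm (exp (\<i> * of_real e * s * of_real (pi / 2)) * lower_gamma_series s (\<i> * of_real (e * R))
           - lower_gamma_series s (of_real R)) \<le> exp (pi / 2 * \<bar>Im s\<bar>) * 2 / R"
proof -
  define w where "w = (\<lambda>t. of_real R * exp (\<i> * of_real e * of_real t))"
  \<comment> \<open>Along the arc, \<open>f\<close> is w^s times the series, divided by R^s. By the
    differential equation, the series drops out of its derivative \<open>f'\<close>, which contains
    only exponentials.\<close>
  define f where "f = (\<lambda>t. exp (\<i> * of_real e * s * of_real t) * lower_gamma_series s (w t))"
  define f' where "f' = (\<lambda>t. \<i> * of_real e * exp (\<i> * of_real e * s * of_real t) * exp (- w t))"
  define K where "K = exp (pi / 2 * \<bar>Im s\<bar>)"
  \<comment> \<open>\<open>K\<close> bounds |exp(i e s t)| on the arc, and cos t \<ge> (pi/2 - t)/2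
    by \<open>sin_ge_half\<close>. Thus \<open>\<phi>'\<close> dominates the norm of
    \<open>f'\<close>, and its primitive \<open>\<phi>\<close> is at most 2 K / R.\<close>
  define \<phi> where "\<phi> = (\<lambda>t. K * 2 / R * exp (- R * (pi / 2 - t) / 2))"
  define \<phi>' where "\<phi>' = (\<lambda>t. K * exp (- R * (pi / 2 - t) / 2))"
  have f: "(f has_vector_derivative f' t) (at t)" for t
  proof -
    obtain D where D: "(lower_gamma_series s has_field_derivative D) (at (w t))"
      and eq: "s * lower_gamma_series s (w t) + w t * D = exp (- w t)"
      using has_field_derivative_lower_gamma_series[OF s] by blast
    have w: "(w has_vector_derivative \<i> * of_real e * w t) (at t)"
      unfolding w_def by (rule has_vector_derivative_real_field) (auto intro!: derivative_eq_intros)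
    have g: "((\<lambda>t. lower_gamma_series s (w t)) has_vector_derivative (\<i> * of_real e * w t * D)) (at t)"
      using field_vector_diff_chain_at[OF w D] by (simp add: o_def)
    have "((\<lambda>t. exp (\<i> * of_real e * s * of_real t)) has_vector_derivative
             \<i> * of_real e * s * exp (\<i> * of_real e * s * of_real t)) (at t)"
      by (rule has_vector_derivative_real_field) (auto intro!: derivative_eq_intros)
    from has_vector_derivative_mult[OF this g] show ?thesis
      unfolding f_def f'_def eq[symmetric] by (simp add: algebra_simps)
  qed
  have \<phi>: "(\<phi> has_vector_derivative \<phi>' t) (at t)" for t
    unfolding \<phi>_def \<phi>'_def has_real_derivative_iff_has_vector_derivative[symmetric]
    using R by (auto intro!: derivative_eq_intros)
  have "norm (f (pi / 2) - f 0) \<le> \<phi> (pi / 2) - \<phi> 0"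
  proof (rule differentiable_bound_general)
    show "continuous_on {0..pi/2} f" "continuous_on {0..pi/2} \<phi>"
      using f \<phi> by (meson continuous_at_imp_continuous_on has_vector_derivative_continuous)+
    show "norm (f' t) \<le> \<phi>' t" if t: "0 < t" "t < pi / 2" for t
    proof -
      have "norm (f' t) = exp (- (e * t * Im s)) * exp (- (R * cos t))"
        using e by (cases "e \<ge> 0") (auto simp: f'_def w_def norm_mult abs_if norm_exp_eq_Re Re_exp algebra_simps split: if_splits)
      also have "\<dots> \<le> K * exp (- R * (pi / 2 - t) / 2)"
      proof (intro mult_mono)
        have "- (e * t * Im s) \<le> \<bar>e * t * Im s\<bar>" by simp
        also have "\<dots> = t * \<bar>Im s\<bar>" using e t by (simp add: abs_mult)
        also have "\<dots> \<le> pi / 2 * \<bar>Im s\<bar>" using t by (intro mult_right_mono) auto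
        finally show "exp (- (e * t * Im s)) \<le> K" by (simp add: K_def)
        have "(pi / 2 - t) / 2 \<le> sin (pi / 2 - t)"
          by (rule sin_ge_half) (use t in auto)
        then have "(pi / 2 - t) / 2 \<le> cos t"
          by (simp add: sin_diff)
        then have "R * ((pi / 2 - t) / 2) \<le> R * cos t"
          using R by (intro mult_left_mono) auto
        then show "exp (- (R * cos t)) \<le> exp (- R * (pi / 2 - t) / 2)"
          by simp
      qed (auto simp: K_def)
      finally show ?thesis by (simp add: \<phi>'_def)
    qed
  qed (use f \<phi> in auto)
  also have "\<dots> \<le> \<phi> (pi / 2)"
    using R by (simp add: \<phi>_def K_def)
  finally have "norm (f (pi / 2) - f 0) \<le> K * 2 / R"
    by (simp add: \<phi>_def)
  moreover have "w (pi / 2) = \<i> * of_real (e * R)"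
  proof -
    have "exp (\<i> * of_real e * of_real (pi / 2)) = \<i> * of_real e"
      using e by (cases "e \<ge> 0") (auto simp: exp_eq_polar cis_conv_exp[symmetric] exp_Euler abs_if complex_eq_iff Re_exp Im_exp split: if_splits)
    then show ?thesis by (simp add: w_def)
  qed
  then have "f (pi / 2) = exp (\<i> * of_real e * s * of_real (pi / 2)) * lower_gamma_series s (\<i> * of_real (e * R))"
    by (simp only: f_def)
  moreover have "f 0 = lower_gamma_series s (of_real R)"
    by (simp add: f_def w_def)
  ultimately show ?thesis
    by (simp only: K_def)
qed

text \<open>Multiplied by R^s, the arc error is O(R^(Re s - 1)), which vanishes exactly because Re s
  < 1. The limit is therefore the one on the real axis, rotated by the phase that w^s picks up along
  the arc.\<close>

lemma tendsto_lower_gamma_series_imag: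
  fixes e :: real
  assumes s: "s \<notin> \<int>\<^sub>\<le>\<^sub>0" "Re s < 1" and e: "\<bar>e\<bar> = 1"
  shows "((\<lambda>R. of_real R powr s * lower_gamma_series s (\<i> * of_real (e * R))) \<longlongrightarrow>
            Gamma s * exp (- (\<i> * of_real e * s * of_real (pi / 2)))) at_top"
proof -
  define E where "E = exp (\<i> * of_real e * s * of_real (pi / 2))"
  define K where "K = exp (pi / 2 * \<bar>Im s\<bar>) * 2"
  let ?g = "lower_gamma_series s"
  have "((\<lambda>R. of_real R powr s * (E * ?g (\<i> * of_real (e * R)) - ?g (of_real R))) \<longlongrightarrow> 0) at_top"
  proof (rule Lim_null_comparison)
    show "\<forall>\<^sub>F R in at_top. norm (of_real R powr s * (E * ?g (\<i> * of_real (e * R)) - ?g (of_real R)))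
            \<le> K * R powr (Re s - 1)"
      using eventually_gt_at_top[of 0]
    proof eventually_elim
      case (elim R)
      have "norm (of_real R powr s * (E * ?g (\<i> * of_real (e * R)) - ?g (of_real R))) =
            R powr Re s * norm (E * ?g (\<i> * of_real (e * R)) - ?g (of_real R))"
        using elim by (simp add: norm_mult norm_powr_real_powr)
      also have "\<dots> \<le> R powr Re s * (K / R)"
        unfolding E_def K_def
        by (intro mult_left_mono lower_gamma_series_arc_bound s e elim) auto
      also have "\<dots> = K * R powr (Re s - 1)"
        using elim by (simp add: powr_diff)
      finally show ?case .
    qed
    show "((\<lambda>R. K * R powr (Re s - 1)) \<longlongrightarrow> 0) at_top"
      using s(2) by (intro tendsto_mult_right_zero tendsto_neg_powr filterlim_ident) auto
  qed
  from tendsto_add[OF this tendsto_lower_gamma_series_real[OF s(1)]]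
  have lim: "((\<lambda>R. E * (of_real R powr s * ?g (\<i> * of_real (e * R)))) \<longlongrightarrow> Gamma s) at_top"
    by (simp add: algebra_simps)
  have canc: "exp (- (\<i> * of_real e * s * of_real (pi / 2))) * (E * y) = y" for y
    by (simp add: E_def exp_minus)
  from tendsto_mult_left[OF lim, of "exp (- (\<i> * of_real e * s * of_real (pi / 2)))"]
  show ?thesis
    by (simp only: canc mult.commute[of "Gamma s"])
qed

section \<open>Tails of the Mellin transform of the cosine\<close>

text \<open>The first term is the Mellin transform of cos(x t) over (0, \<infinity>), the second the
  part over (0, 1), both in analytically continued form; the difference is the integral from 1 to
  \<infinity>.\<close>

definition cos_tail :: "complex \<Rightarrow> real \<Rightarrow> complex" where
  "cos_tail s x = Gamma s * of_real x powr (- s) * cos (of_real pi * s / 2)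
     - (lower_gamma_series s (\<i> * of_real x) + lower_gamma_series s (- \<i> * of_real x)) / 2"

lemma tendsto_integral_powr_cos:
  assumes s: "s \<notin> \<int>\<^sub>\<le>\<^sub>0" "Re s < 1" and x: "x > 0"
  shows "((\<lambda>N. integral {1..N} (\<lambda>t. of_real t powr (s - 1) * of_real (cos (x * t))))
            \<longlongrightarrow> cos_tail s x) at_top"
proof -
  let ?g = "lower_gamma_series s"
  \<comment> \<open>Up to the argument scaling, \<open>G e\<close> is a primitive of t^(s-1) exp(-i
    e x t). Averaging over e = 1 and e = -1 produces the cosine in the integrand and cos(pi s / 2)
    in the limit.\<close>
  define G where "G = (\<lambda>e N. of_real N powr s * ?g (\<i> * of_real (e * (x * N))))"
  have lim: "((\<lambda>N. G e N) \<longlongrightarrow> of_real x powr (- s) * (Gamma s * exp (- (\<i> * of_real e * s * of_real (pi / 2))))) at_top"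
    if e: "\<bar>e\<bar> = 1" for e
  proof -
    have "filterlim (\<lambda>N. x * N) at_top at_top"
      using x by (intro filterlim_tendsto_pos_mult_at_top[OF tendsto_const] filterlim_ident)
    from tendsto_mult_left[OF filterlim_compose[OF tendsto_lower_gamma_series_imag[OF s e] this], of "of_real x powr (- s)"]
    have "((\<lambda>N. of_real x powr (- s) * (of_real (x * N) powr s * ?g (\<i> * of_real (e * (x * N))))) \<longlongrightarrow>
       of_real x powr (- s) * (Gamma s * exp (- (\<i> * of_real e * s * of_real (pi / 2))))) at_top" .
    moreover have "\<forall>\<^sub>F N in at_top. of_real x powr (- s) * (of_real (x * N) powr s * ?g (\<i> * of_real (e * (x * N)))) = G e N"
      using eventually_gt_at_top[of 0]
    proof eventually_elim
      case (elim N)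
      have "of_real (x * N) powr s = of_real x powr s * (of_real N powr s :: complex)"
        using x elim by (simp add: powr_times_real)
      then show ?case
        using x by (simp add: G_def powr_minus)
    qed
    ultimately show ?thesis by (rule Lim_transform_eventually)
  qed
  have int: "integral {1..N} (\<lambda>t. of_real t powr (s - 1) * of_real (cos (x * t)))
         = (G 1 N + G (-1) N) / 2 - (G 1 1 + G (-1) 1) / 2" if "N \<ge> 1" for N
  proof (rule integral_unique, rule has_integral_eq_rhs)
    have der: "(G e has_vector_derivative of_real t powr (s - 1) * exp (- (\<i> * of_real e * of_real (x * t)))) (at t within {1..N})"
      if "t \<ge> 1" for t e
      using powr_lower_gamma_series_has_vector_derivative[OF s(1), of t "\<i> * of_real (e * x)" "{1..N}"] that
      by (simp add: G_def mult_ac)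
    show "((\<lambda>t. of_real t powr (s - 1) * of_real (cos (x * t))) has_integral
            (G 1 N + G (-1) N) / 2 - (G 1 1 + G (-1) 1) / 2) {1..N}"
    proof (rule fundamental_theorem_of_calculus[OF that])
      fix t assume t: "t \<in> {1..N}"
      have "((\<lambda>t. (G 1 t + G (-1) t) / 2) has_vector_derivative
              (of_real t powr (s - 1) * exp (- (\<i> * of_real 1 * of_real (x * t))) +
               of_real t powr (s - 1) * exp (- (\<i> * of_real (-1) * of_real (x * t)))) / 2) (at t within {1..N})"
        using t by (intro has_vector_derivative_divide has_vector_derivative_add der) auto
      moreover have "of_real (cos (x * t)) = (exp (- (\<i> * of_real 1 * of_real (x * t))) +
               exp (- (\<i> * of_real (-1) * of_real (x * t)))) / 2"
        by (simp add: cos_of_real[symmetric] cos_exp_eq add.commute)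
      ultimately show "((\<lambda>t. (G 1 t + G (-1) t) / 2) has_vector_derivative
              of_real t powr (s - 1) * of_real (cos (x * t))) (at t within {1..N})"
        by (simp add: algebra_simps add_divide_distrib)
    qed
  qed simp
  have "((\<lambda>N. (G 1 N + G (-1) N) / 2 - (G 1 1 + G (-1) 1) / 2) \<longlongrightarrow>
     (of_real x powr (- s) * (Gamma s * exp (- (\<i> * of_real 1 * s * of_real (pi / 2)))) +
      of_real x powr (- s) * (Gamma s * exp (- (\<i> * of_real (-1) * s * of_real (pi / 2))))) / 2
        - (G 1 1 + G (-1) 1) / 2) at_top"
    by (intro tendsto_intros lim) auto
  also have "(of_real x powr (- s) * (Gamma s * exp (- (\<i> * of_real 1 * s * of_real (pi / 2)))) +
      of_real x powr (- s) * (Gamma s * exp (- (\<i> * of_real (-1) * s * of_real (pi / 2))))) / 2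
        - (G 1 1 + G (-1) 1) / 2 = cos_tail s x"
    by (simp add: cos_tail_def G_def cos_exp_eq algebra_simps add_divide_distrib)
  finally show ?thesis
  proof (rule Lim_transform_eventually)
    show "\<forall>\<^sub>F N in at_top. (G 1 N + G (-1) N) / 2 - (G 1 1 + G (-1) 1) / 2 =
        integral {1..N} (\<lambda>t. of_real t powr (s - 1) * of_real (cos (x * t)))"
      using eventually_ge_at_top[of 1] by eventually_elim (simp add: int)
  qed
qed

text \<open>Odd powers cancel between the two arguments. For Re s > 0 the result is the cosine
  series integrated termwise against t^(s-1) over (0, 1).\<close>

lemma lower_gamma_series_even_sums:
  "(\<lambda>m. (-1) ^ m * of_real (x ^ (2 * m)) / (fact (2 * m) * (s + of_nat (2 * m)))) sums
     ((lower_gamma_series s (\<i> * of_real x) + lower_gamma_series s (- \<i> * of_real x)) / 2)"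
proof -
  define f where "f = (\<lambda>n. ((-1) ^ n / (fact n * (s + of_nat n)) * (\<i> * of_real x) ^ n
       + (-1) ^ n / (fact n * (s + of_nat n)) * (- \<i> * of_real x) ^ n) / 2)"
  have "f sums ((lower_gamma_series s (\<i> * of_real x) + lower_gamma_series s (- \<i> * of_real x)) / 2)"
    unfolding f_def by (intro sums_divide sums_add lower_gamma_series_sums)
  moreover have "f n = 0" if "n \<notin> range (\<lambda>m. 2 * m)" for n
  proof -
    from that have "odd n" by (auto elim!: evenE)
    then show ?thesis by (simp add: f_def power_mult_distrib)
  qed
  ultimately have "(\<lambda>m. f (2 * m)) sums ((lower_gamma_series s (\<i> * of_real x) + lower_gamma_series s (- \<i> * of_real x)) / 2)"
    by (subst sums_mono_reindex) (auto simp: strict_mono_def)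
  moreover have "f (2 * m) = (-1) ^ m * of_real (x ^ (2 * m)) / (fact (2 * m) * (s + of_nat (2 * m)))" for m
  proof -
    have "(\<i> * of_real x) ^ (2 * m) = (-1) ^ m * of_real (x ^ (2 * m))"
      by (simp only: power_mult_distrib power_mult power2_i of_real_power)
    moreover have "(- \<i> * of_real x) ^ (2 * m) = (\<i> * of_real x) ^ (2 * m)"
      by (simp add: power_mult_distrib power_mult)
    ultimately show ?thesis
      by (simp add: f_def)
  qed
  ultimately show ?thesis by simp
qed

section \<open>Integrals over the half line from 1\<close>

text \<open>Two separate frequencies let one function serve both halves of H: (z, x, 1) for t > 1
  and, after inversion, (-z, 1, x) for t < 1.\<close>

definition trunc_integral :: "complex \<Rightarrow> real \<Rightarrow> real \<Rightarrow> real \<Rightarrow> complex" where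
  "trunc_integral z x y N =
     integral {1..N} (\<lambda>t. of_real t powr (z - 1) * of_real (cos (x * t)) * of_real (cos (y / t)))"

lemma summable_even_exp: "summable (\<lambda>k. \<bar>y\<bar> ^ (2 * k) / fact (2 * k) :: real)"
proof -
  have "summable (\<lambda>n. \<bar>y\<bar> ^ n / fact n)"
    using summable_exp[of "\<bar>y\<bar>"] by (simp add: divide_inverse mult.commute)
  then have "summable (\<lambda>n. if even n then \<bar>y\<bar> ^ n / fact n else 0)"
    by (rule summable_comparison_test[rotated]) auto
  then show ?thesis
    by (subst (asm) summable_mono_reindex[symmetric, of "\<lambda>k. 2 * k"])
       (auto simp: strict_mono_def elim!: evenE)
qed

lemma norm_powr_of_real: "t > 0 \<Longrightarrow> norm (of_real t powr s :: complex) = t powr Re s"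
  by (simp add: norm_powr_real_powr)

lemma strip_nonzero_not_Ints:
  assumes "\<bar>Re z\<bar> < 1" "z \<noteq> 0"
  shows "z \<notin> \<int>"
  using assms by (auto elim!: Ints_cases)

text \<open>
  Expand \<open>cos (y / t)\<close> and integrate termwise. Only the term \<open>k = 0\<close> is not absolutely convergent,
  so a dominating series is available for all \<open>k \<ge> 1\<close>, which is what Tannery's theorem needs.
\<close>

lemma tendsto_trunc_integral:
  assumes z: "\<bar>Re z\<bar> < 1" "z \<noteq> 0" and x: "x > 0"
  shows "(trunc_integral z x y \<longlongrightarrow>
     (\<Sum>k. (-1) ^ k * of_real (y ^ (2 * k)) / fact (2 * k) * cos_tail (z - of_nat (2 * k)) x)) at_top"
    and "summable (\<lambda>k. norm ((-1) ^ k * of_real (y ^ (2 * k)) / fact (2 * k) * cos_tail (z - of_nat (2 * k)) x))"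
proof -
  define c :: "nat \<Rightarrow> complex" where "c = (\<lambda>k. (-1) ^ k * of_real (y ^ (2 * k)) / fact (2 * k))"
  define M where "M = (\<lambda>k. \<bar>y\<bar> ^ (2 * k) / fact (2 * k))"
  define h where "h = (\<lambda>k t. of_real t powr (z - of_nat (2 * k) - 1) * of_real (cos (x * t)) :: complex)"
  have cM: "norm (c k) = M k" for k
    by (simp add: c_def M_def norm_mult norm_divide norm_power power_abs)
  have M: "summable M"
    unfolding M_def by (rule summable_even_exp)
  have nonint: "z - of_nat (2 * k) \<notin> \<int>" for k
  proof
    assume "z - of_nat (2 * k) \<in> \<int>"
    then have "z \<in> \<int>" using Ints_add[OF _ Ints_of_nat[of "2 * k"]] by fastforce
    with strip_nonzero_not_Ints[OF z] show False by contradiction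
  qed
  have cont_h: "continuous_on {1..N} (h k)" for N k
    unfolding h_def by (intro continuous_intros) auto
  have norm_h: "norm (h k t) \<le> t powr (Re z - 2 * real k - 1)" if "t \<ge> 1" for k t
    using that by (auto simp: h_def norm_mult norm_powr_of_real intro!: mult_left_le)
  have norm_h1: "norm (h k t) \<le> 1" if "t \<ge> 1" for k t
  proof -
    have "t powr (Re z - 2 * real k - 1) \<le> t powr 0"
      using that z by (intro powr_mono) auto
    with norm_h[OF that, of k] that show ?thesis by simp
  qed
  \<comment> \<open>Since \<open>z\<close> is not an integer, no \<open>z - of_nat (2 * k)\<close>
    is a pole of Gamma, so the tail formula applies to every term.\<close>
  have lim: "((\<lambda>N. c k * integral {1..N} (h k)) \<longlongrightarrow> c k * cos_tail (z - of_nat (2 * k)) x) at_top" for k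
    unfolding h_def
    by (intro tendsto_intros tendsto_integral_powr_cos) (use nonint[of k] nonpos_Ints_Int z x in auto)
  have bound: "eventually (\<lambda>(k, N). norm (c k * integral {1..N} (h k)) \<le> M k) (at_top \<times>\<^sub>F at_top)"
  proof -
    have le: "norm (c k * integral {1..N} (h k)) \<le> M k" if "k \<ge> 1" "N \<ge> 1" for k N
    proof -
      \<comment> \<open>For k \<ge> 1 the exponent Re z - 2k - 1 is below -2, so each integral is at
        most the integral of t^(-2) over (1, \<infinity>), which is 1, independently of
        \<open>k\<close> and \<open>N\<close>.\<close>
      have *: "((\<lambda>t. t powr (-2)) has_integral (- inverse N - - inverse 1)) {1..N}"
        using that by (intro fundamental_theorem_of_calculus)
          (auto intro!: derivative_eq_intros simp: has_real_derivative_iff_has_vector_derivative[symmetric] powr_minus power2_eq_square field_simps)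
      have "norm (integral {1..N} (h k)) \<le> integral {1..N} (\<lambda>t. t powr (-2))"
      proof (rule integral_norm_bound_integral)
        show "h k integrable_on {1..N}" by (intro integrable_continuous_real cont_h)
        show "(\<lambda>t. t powr (-2)) integrable_on {1..N}" using * by blast
        show "norm (h k t) \<le> t powr (-2)" if t: "t \<in> {1..N}" for t
        proof -
          have "t powr (Re z - 2 * real k - 1) \<le> t powr (-2)"
            using t z \<open>k \<ge> 1\<close> by (intro powr_mono) auto
          with norm_h[of t k] t show ?thesis by simp
        qed
      qed
      also have "\<dots> \<le> 1"
        using * that by (simp add: integral_unique)
      finally have "norm (c k) * norm (integral {1..N} (h k)) \<le> norm (c k) * 1"
        by (intro mult_left_mono) auto
      then show ?thesis by (simp add: norm_mult cM)
    qed
    show ?thesis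
      unfolding eventually_prod_filter
      by (rule exI[of _ "\<lambda>k. k \<ge> 1"], rule exI[of _ "\<lambda>N. N \<ge> 1"])
         (use le eventually_ge_at_top in auto)
  qed
  have swap: "(\<Sum>k. c k * integral {1..N} (h k)) = trunc_integral z x y N" for N
  proof -
    define f where "f = (\<lambda>t. of_real t powr (z - 1) * of_real (cos (x * t)) * of_real (cos (y / t)) :: complex)"
    have pt: "(\<lambda>k. c k * h k t) sums f t" if "t \<in> {1..N}" for t
    proof -
      have "(\<lambda>n. (-1) ^ n / fact (2 * n) * (y / t) ^ (2 * n)) sums cos (y / t)"
        using cos_paired[of "y / t"] by simp
      then have "(\<lambda>n. of_real ((-1) ^ n / fact (2 * n) * (y / t) ^ (2 * n)) :: complex) sums of_real (cos (y / t))"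
        by (rule sums_of_real)
      from sums_mult[OF this, of "of_real t powr (z - 1) * of_real (cos (x * t))"]
      have "(\<lambda>n. of_real t powr (z - 1) * of_real (cos (x * t)) * of_real ((-1) ^ n / fact (2 * n) * (y / t) ^ (2 * n))) sums f t"
        by (simp add: f_def)
      moreover have "of_real t powr (z - 1) * of_real (cos (x * t)) * of_real ((-1) ^ n / fact (2 * n) * (y / t) ^ (2 * n)) = c n * h n t" for n
      proof -
        have "(of_real t powr (z - of_nat (2 * n) - 1) :: complex) = of_real t powr (z - 1 - of_nat (2 * n))"
          by (simp add: algebra_simps)
        also have "\<dots> = of_real t powr (z - 1) / of_real (t ^ (2 * n))"
        proof -
          have "of_real t powr of_nat (2 * n) = (of_real t ^ (2 * n) :: complex)"
            by (rule powr_nat') (use that in auto)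
          then show ?thesis by (simp only: powr_diff of_real_power)
        qed
        finally show ?thesis
          by (simp add: c_def h_def power_divide)
      qed
      ultimately show ?thesis by simp
    qed
    \<comment> \<open>On a bounded interval the term k = 0 causes no trouble either: every |h k t|
      is at most 1, so the M-test applies with the majorant \<open>M\<close>.\<close>
    have "uniform_limit {1..N} (\<lambda>n t. \<Sum>k<n. c k * h k t) (\<lambda>t. \<Sum>k. c k * h k t) sequentially"
    proof (rule Weierstrass_m_test)
      show "norm (c k * h k t) \<le> M k" if "t \<in> {1..N}" for k t
        using mult_left_mono[OF norm_h1[of t k] norm_ge_zero[of "c k"]] that by (simp add: norm_mult cM)
    qed (rule M)
    then have ul: "uniform_limit {1..N} (\<lambda>n t. \<Sum>k<n. c k * h k t) f sequentially"
      by (rule uniform_limit_cong'[THEN iffD1, rotated -1]) (use pt in \<open>auto simp: sums_iff\<close>)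
    have "continuous_on {1..N} (\<lambda>t. \<Sum>k<n. c k * h k t)" for n
      by (intro continuous_intros cont_h)
    then obtain I J where IJ: "\<And>n. ((\<lambda>t. \<Sum>k<n. c k * h k t) has_integral I n) {1..N}"
        "(f has_integral J) {1..N}" "I \<longlonglongrightarrow> J"
      using uniform_limit_integral[OF ul] sequentially_bot by metis
    then have "(\<lambda>n. integral {1..N} (\<lambda>t. \<Sum>k<n. c k * h k t)) \<longlonglongrightarrow> integral {1..N} f"
      by (simp add: integral_unique[OF IJ(1)] integral_unique[OF IJ(2)])
    moreover have "integral {1..N} (\<lambda>t. \<Sum>k<n. c k * h k t) = (\<Sum>k<n. c k * integral {1..N} (h k))" for n
    proof -
      have "integral {1..N} (\<lambda>t. \<Sum>k<n. c k * h k t) = (\<Sum>k<n. integral {1..N} (\<lambda>t. c k * h k t))"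
        by (rule integral_sum) (auto intro!: integrable_continuous_real continuous_intros cont_h)
      then show ?thesis by simp
    qed
    ultimately have "(\<lambda>k. c k * integral {1..N} (h k)) sums integral {1..N} f"
      by (simp add: sums_def)
    then show ?thesis by (simp add: sums_iff trunc_integral_def f_def)
  qed
  from tannerys_theorem[OF lim bound M]
  have "((\<lambda>N. \<Sum>k. c k * integral {1..N} (h k)) \<longlongrightarrow> (\<Sum>k. c k * cos_tail (z - of_nat (2 * k)) x)) at_top"
    and *: "summable (\<lambda>k. norm (c k * cos_tail (z - of_nat (2 * k)) x))" by auto
  then show "(trunc_integral z x y \<longlongrightarrow>
     (\<Sum>k. (-1) ^ k * of_real (y ^ (2 * k)) / fact (2 * k) * cos_tail (z - of_nat (2 * k)) x)) at_top"
    unfolding swap by (simp add: c_def)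
  from * show "summable (\<lambda>k. norm ((-1) ^ k * of_real (y ^ (2 * k)) / fact (2 * k) * cos_tail (z - of_nat (2 * k)) x))"
    by (simp add: c_def)
qed

text \<open>
  Integration by parts against \<open>sin (x t) / x\<close>: subtracting the boundary term leaves a function \<open>\<Phi>\<close>
  of the upper limit whose derivative is \<open>O(t powr (- 3 / 2))\<close>, uniformly in \<open>z\<close>.
\<close>

lemma trunc_integral_cauchy:
  assumes z: "norm z \<le> 1 / 2" and x: "x > 0" and N: "1 \<le> N" "N \<le> M"
  shows "norm (trunc_integral z x y M - trunc_integral z x y N) \<le> (2 * \<bar>y\<bar> + 6) / x * N powr (- 1 / 2)"
proof (cases "N = M")
  case False
  with N have "N < M" by simp
  have Re: "\<bar>Re z\<bar> \<le> 1 / 2" using z abs_Re_le_cmod[of z] by linarith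
  define u :: "real \<Rightarrow> complex" where "u = (\<lambda>t. of_real t powr (z - 1) * of_real (cos (y / t)))"
  define u' :: "real \<Rightarrow> complex" where "u' = (\<lambda>t. of_real t powr (z - 1) * of_real (sin (y / t) * (y / t\<^sup>2))
      + (z - 1) * of_real t powr (z - 1 - 1) * of_real (cos (y / t)))"
  define f where "f = (\<lambda>t. u t * of_real (cos (x * t)))"
  define \<Phi> where "\<Phi> = (\<lambda>T. integral {1..T} f - u T * of_real (sin (x * T) / x))"
  have T: "trunc_integral z x y = (\<lambda>T. integral {1..T} f)"
    unfolding trunc_integral_def f_def u_def by (simp add: mult_ac)
  have cont: "continuous_on {1..M+1} f"
    unfolding f_def u_def by (intro continuous_intros) auto
  have u: "(u has_vector_derivative u' t) (at t)" if "t \<ge> 1" for t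
    unfolding u_def u'_def
    by (intro has_vector_derivative_mult powr_of_real_has_vector_derivative has_vector_derivative_of_real)
       (use that in \<open>auto intro!: derivative_eq_intros simp: power2_eq_square simp flip: has_real_derivative_iff_has_vector_derivative\<close>)
  have \<Phi>: "(\<Phi> has_vector_derivative - (u' t * of_real (sin (x * t) / x))) (at t)" if "t \<in> {N<..<M}" for t
  proof -
    have "((\<lambda>T. integral {1..T} f) has_vector_derivative f t) (at t within {1..M+1})"
      by (rule integral_has_vector_derivative[OF cont]) (use that N in auto)
    then have "((\<lambda>T. integral {1..T} f) has_vector_derivative f t) (at t)"
      using that N by (subst (asm) at_within_interior) auto
    moreover have "((\<lambda>T. u T * of_real (sin (x * T) / x)) has_vector_derivative
          u t * of_real (cos (x * t)) + u' t * of_real (sin (x * t) / x)) (at t)"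
      by (intro has_vector_derivative_mult u has_vector_derivative_of_real)
       (use that N x in \<open>auto intro!: derivative_eq_intros simp flip: has_real_derivative_iff_has_vector_derivative\<close>)
    ultimately have "(\<Phi> has_vector_derivative f t - (u t * of_real (cos (x * t)) + u' t * of_real (sin (x * t) / x))) (at t)"
      unfolding \<Phi>_def by (rule has_vector_derivative_diff)
    then show ?thesis by (simp add: f_def)
  qed
  \<comment> \<open>In the bound for \<open>u'\<close>, |y| comes from differentiating cos(y / t)
    and 2 from |z - 1| \<le> 2; the factor 1 / x comes from the primitive of cos(x t).\<close>
  define K where "K = (\<bar>y\<bar> + 2) / x"
  have norm_u: "norm (u t) \<le> t powr (- 1 / 2)" if "t \<ge> 1" for t
  proof -
    have "norm (u t) \<le> t powr (Re z - 1)"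
      using that by (auto simp: u_def norm_mult norm_powr_of_real intro!: mult_left_le)
    also have "\<dots> \<le> t powr (- 1 / 2)"
      using that Re by (intro powr_mono) auto
    finally show ?thesis .
  qed
  have norm_u': "norm (u' t) \<le> (\<bar>y\<bar> + 2) * t powr (- 3 / 2)" if t: "t \<ge> 1" for t
  proof -
    have "norm (u' t) \<le> t powr (Re z - 1) * (\<bar>sin (y / t)\<bar> * (\<bar>y\<bar> / t\<^sup>2)) + norm (z - 1) * t powr (Re z - 1 - 1) * \<bar>cos (y / t)\<bar>"
      unfolding u'_def using t
      by (intro norm_triangle_le) (simp add: norm_mult norm_divide norm_powr_of_real norm_power abs_mult)
    also have "\<dots> \<le> t powr (Re z - 1) * (1 * (\<bar>y\<bar> / t powr 1)) + 2 * t powr (Re z - 1 - 1) * 1"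
    proof (intro add_mono mult_mono divide_left_mono)
      show "norm (z - 1) \<le> 2"
        using norm_triangle_ineq4[of z 1] z by simp
      show "t powr 1 \<le> t\<^sup>2" using t by (simp add: self_le_power)
    qed (use t in auto)
    also have "\<dots> = (\<bar>y\<bar> + 2) * t powr (Re z - 2)"
      using t by (simp add: powr_diff field_simps power2_eq_square)
    also have "\<dots> \<le> (\<bar>y\<bar> + 2) * t powr (- 3 / 2)"
      using t Re by (intro mult_left_mono powr_mono) auto
    finally show ?thesis .
  qed
  \<comment> \<open>The comparison function -2 K t^(-1/2) is a primitive of the majorant K
    t^(-3/2).\<close>
  have "norm (\<Phi> M - \<Phi> N) \<le> - 2 * K * M powr (- 1 / 2) - (- 2 * K * N powr (- 1 / 2))"
  proof (rule differentiable_bound_general[OF \<open>N < M\<close>])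
    have "continuous_on {N..M} (\<lambda>T. integral {1..T} f)"
      by (rule continuous_on_subset[OF indefinite_integral_continuous_1[OF integrable_continuous_real[OF cont]]])
         (use N in auto)
    moreover have "continuous_on {N..M} u"
      using N unfolding u_def by (intro continuous_intros) auto
    ultimately show "continuous_on {N..M} \<Phi>"
      using x unfolding \<Phi>_def by (intro continuous_intros) auto
    show "continuous_on {N..M} (\<lambda>t. - 2 * K * t powr (- 1 / 2))"
      using N by (intro continuous_intros) auto
    show "((\<lambda>t. - 2 * K * t powr (- 1 / 2)) has_vector_derivative K * t powr (- 3 / 2)) (at t)"
      if "N < t" for t
      unfolding has_real_derivative_iff_has_vector_derivative[symmetric] using that N
      by (auto intro!: derivative_eq_intros)
    show "norm (- (u' t * of_real (sin (x * t) / x))) \<le> K * t powr (- 3 / 2)" if "N < t" for t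
    proof -
      have "norm (- (u' t * of_real (sin (x * t) / x))) = norm (u' t) / x * \<bar>sin (x * t)\<bar>"
        using x by (simp add: norm_mult norm_divide)
      also have "\<dots> \<le> norm (u' t) / x"
        using x by (intro mult_left_le) auto
      also have "\<dots> \<le> (\<bar>y\<bar> + 2) * t powr (- 3 / 2) / x"
        using that N x by (intro divide_right_mono norm_u') auto
      finally show ?thesis by (simp add: K_def)
    qed
  qed (use \<Phi> in auto)
  also have "\<dots> \<le> 2 * K * N powr (- 1 / 2)"
  proof -
    have "2 * K * M powr (- 1 / 2) \<ge> 0" using x by (auto simp: K_def)
    then show ?thesis by linarith
  qed
  finally have 1: "norm (\<Phi> M - \<Phi> N) \<le> 2 * K * N powr (- 1 / 2)" .
  have 2: "norm (u t * of_real (sin (x * t) / x)) \<le> N powr (- 1 / 2) / x" if "t \<ge> N" for t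
  proof -
    have "norm (u t * of_real (sin (x * t) / x)) = norm (u t) / x * \<bar>sin (x * t)\<bar>"
      using x by (simp add: norm_mult norm_divide)
    also have "\<dots> \<le> norm (u t) / x"
      using x by (intro mult_left_le) auto
    also have "norm (u t) \<le> N powr (- 1 / 2)"
    proof -
      have "t powr (- 1 / 2) \<le> N powr (- 1 / 2)"
        by (rule powr_mono2') (use that N in auto)
      with norm_u[of t] that N show ?thesis by linarith
    qed
    finally show ?thesis using x by (simp add: divide_right_mono)
  qed
  have "trunc_integral z x y M - trunc_integral z x y N =
      (\<Phi> M - \<Phi> N) + (u M * of_real (sin (x * M) / x) - u N * of_real (sin (x * N) / x))"
    unfolding T \<Phi>_def by simp
  \<comment> \<open>The two boundary terms contribute 2 / x on top of 2 K, which gives the constant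
    (2 |y| + 6) / x.\<close>
  also have "norm \<dots> \<le> 2 * K * N powr (- 1 / 2) + (N powr (- 1 / 2) / x + N powr (- 1 / 2) / x)"
    using N by (intro norm_triangle_le add_mono 1 norm_triangle_le_diff 2) auto
  also have "\<dots> = (2 * \<bar>y\<bar> + 6) / x * N powr (- 1 / 2)"
    using x by (simp add: K_def field_simps)
  finally show ?thesis .
qed (use x in auto)

text \<open>The Cauchy bound does not depend on \<open>z\<close> in the closed disc of radius 1/2,
  so the limits are uniform there and inherit continuity. This provides the passage to z = 0, where
  the termwise formula meets a pole of Gamma.\<close>

lemma trunc_integral_limit_near_0:
  assumes x: "x > 0"
  obtains L where "\<And>z. norm z \<le> 1 / 2 \<Longrightarrow> (trunc_integral z x y \<longlongrightarrow> L z) at_top"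
    and "isCont L 0"
proof -
  define A :: "complex set" where "A = cball 0 (1 / 2)"
  define c where "c = (\<lambda>N::real. (2 * \<bar>y\<bar> + 6) / x * N powr (- 1 / 2))"
  let ?T = "\<lambda>z. trunc_integral z x y"
  have c0: "(c \<longlongrightarrow> 0) at_top"
    unfolding c_def by (intro tendsto_mult_right_zero tendsto_neg_powr filterlim_ident) auto
  have cauchy: "norm (?T z M - ?T z N) \<le> c N" if "z \<in> A" "1 \<le> N" "N \<le> M" for z M N
    unfolding c_def by (rule trunc_integral_cauchy) (use that x in \<open>auto simp: A_def\<close>)
  have "\<exists>l. (\<lambda>n. ?T z (real n)) \<longlonglongrightarrow> l" if z: "z \<in> A" for z
  proof -
    have "Cauchy (\<lambda>n. ?T z (real n))"
      unfolding Cauchy_altdef2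
    proof (intro allI impI)
      fix e :: real assume e: "e > 0"
      have "\<forall>\<^sub>F n in sequentially. c (real n) < e"
        by (rule order_tendstoD(2)[OF filterlim_compose[OF c0 filterlim_real_sequentially] e])
      from eventually_happens'[OF sequentially_bot eventually_conj[OF this eventually_ge_at_top[of 1]]]
      obtain n where n: "c (real n) < e" "n \<ge> 1" by blast
      show "\<exists>N. \<forall>m\<ge>N. dist (?T z (real m)) (?T z (real N)) < e"
      proof (intro exI[of _ n] allI impI)
        fix m assume "m \<ge> n"
        then show "dist (?T z (real m)) (?T z (real n)) < e"
          using n cauchy[OF z, of "real n" "real m"] by (simp add: dist_norm)
      qed
    qed
    then show ?thesis by (simp add: Cauchy_convergent_iff convergent_def)
  qed
  then obtain L where L: "\<And>z. z \<in> A \<Longrightarrow> (\<lambda>n. ?T z (real n)) \<longlonglongrightarrow> L z" by metis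
  \<comment> \<open>\<open>L\<close> was obtained along the integers by completeness. Letting only
    the upper limit run through the integers gives the same bound for every real
    \<open>N\<close>.\<close>
  have diff: "norm (L z - ?T z N) \<le> c N" if "z \<in> A" "1 \<le> N" for z N
  proof (rule tendsto_upperbound)
    show "(\<lambda>n. norm (?T z (real n) - ?T z N)) \<longlonglongrightarrow> norm (L z - ?T z N)"
      by (intro tendsto_intros L that)
    show "\<forall>\<^sub>F n in sequentially. norm (?T z (real n) - ?T z N) \<le> c N"
      using eventually_ge_at_top[of "nat \<lceil>N\<rceil>"] 
      by eventually_elim (rule cauchy[OF that], linarith)
  qed auto
  have ul: "uniform_limit A (\<lambda>N z. ?T z N) L at_top"
  proof (rule uniform_limitI)
    fix e :: real assume "e > 0"
    from order_tendstoD(2)[OF c0 this] eventually_ge_at_top[of 1]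
    show "\<forall>\<^sub>F N in at_top. \<forall>z\<in>A. dist (?T z N) (L z) < e"
    proof eventually_elim
      case (elim N)
      then show ?case
        using diff[of _ N] by (auto simp: dist_norm norm_minus_commute[of "L _"] intro: le_less_trans)
    qed
  qed
  have "continuous_on A L"
  proof (rule uniform_limit_theorem[OF _ ul])
    have "continuous_on A (\<lambda>z. ?T z N)" for N
    proof -
      have "continuous_on (A \<times> cbox 1 N) (\<lambda>(z, t). of_real t powr (z - 1) * of_real (cos (x * t)) * of_real (cos (y / t)) :: complex)"
        unfolding split_def by (intro continuous_intros) auto
      then show ?thesis
        unfolding trunc_integral_def using integral_continuous_on_param[of A 1 N] by simp
    qed
    then show "\<forall>\<^sub>F N in at_top. continuous_on A (\<lambda>z. ?T z N)" by simp
  qed simp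
  then have "continuous_on (ball 0 (1/2)) L"
    by (rule continuous_on_subset) (auto simp: A_def)
  then have "isCont L 0"
    by (subst (asm) continuous_on_eq_continuous_at) auto
  then show ?thesis
    using that[of L] tendsto_uniform_limitI[OF ul] by (auto simp: A_def)
qed

section \<open>Inversion of (0, 1) and the improper integral\<close>

text \<open>Under t = 1/u, cos(x t) cos(1/t) becomes cos(x/u) cos(u) and t^(z-1) dt becomes u^(-z-1)
  du up to orientation: the frequencies trade places and \<open>z\<close> changes sign.\<close>

lemma integral_H1_integrand:
  assumes "0 < a" "a \<le> 1" "1 \<le> b"
  shows "integral {a..b} (H1_integrand z x) = trunc_integral (- z) 1 x (1 / a) + trunc_integral z x 1 b"
proof -
  have cont: "continuous_on {c..d} (H1_integrand z x)" if "c > 0" for c d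
    unfolding H1_integrand_def using that by (intro continuous_intros) auto
  have "((\<lambda>u. (- 1 / u\<^sup>2) *\<^sub>R H1_integrand z x (1 / u)) has_integral
     (integral {1 / 1..1 / (1 / a)} (H1_integrand z x) - integral {1 / (1 / a)..1 / 1} (H1_integrand z x))) {1..1 / a}"
  proof (rule has_integral_substitution_general)
    show "(\<lambda>u. 1 / u) ` {1..1/a} \<subseteq> {a..1}" using assms by (auto simp: field_simps)
    show "continuous_on {a..1} (H1_integrand z x)" using cont assms by auto
    show "continuous_on {1..1/a} (\<lambda>u. 1 / u)" by (intro continuous_intros) auto
    show "((\<lambda>u. 1 / u) has_field_derivative - 1 / u\<^sup>2) (at u within {1..1/a})" if "u \<in> {1..1/a} - {}" for u
      using that by (auto intro!: derivative_eq_intros simp: power2_eq_square)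
  qed (use assms in \<open>auto simp: field_simps\<close>)
  \<comment> \<open>The substitution rule yields a difference over both orientations. As 1/u
    decreases, the first interval is empty or a single point, and only the second integral, with a
    minus sign, remains.\<close>
  moreover have "integral {1..a} (H1_integrand z x) = 0"
    using assms by (cases "a = 1") auto
  ultimately have "((\<lambda>u. (- 1 / u\<^sup>2) *\<^sub>R H1_integrand z x (1 / u)) has_integral - integral {a..1} (H1_integrand z x)) {1..1/a}"
    by simp
  from has_integral_neg[OF this]
  have "((\<lambda>u. (1 / u\<^sup>2) *\<^sub>R H1_integrand z x (1 / u)) has_integral integral {a..1} (H1_integrand z x)) {1..1/a}"
    by simp
  moreover have "(1 / u\<^sup>2) *\<^sub>R H1_integrand z x (1 / u) = of_real u powr (- z - 1) * of_real (cos (1 * u)) * of_real (cos (x / u))"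
    if "u \<in> {1..1/a}" for u
  proof -
    have u: "u > 0" using that by simp
    have "(of_real (1 / u) :: complex) powr (z - 1) * of_real u powr (z - 1) = 1"
      using u powr_times_real[of "of_real (1 / u)" "of_real u" "z - 1"] by simp
    then have "(of_real (1 / u) :: complex) powr (z - 1) = of_real u powr (- (z - 1))"
      unfolding powr_minus by (intro inverse_unique[symmetric]) (simp only: mult.commute)
    moreover have "of_real (u\<^sup>2) = (of_real u powr 2 :: complex)"
      by simp
    ultimately have "of_real (1 / u) powr (z - 1) / of_real (u\<^sup>2) = (of_real u powr (- (z - 1) - 2) :: complex)"
      by (simp only: powr_diff[of _ "- (z - 1)" 2])
    also have "- (z - 1) - 2 = - z - 1"
      by simp
    finally have "of_real (1 / u) powr (z - 1) / of_real (u\<^sup>2) = (of_real u powr (- z - 1) :: complex)" .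
    then show ?thesis
      by (simp add: H1_integrand_def scaleR_conv_of_real mult_ac divide_inverse)
  qed
  ultimately have "((\<lambda>u. of_real u powr (- z - 1) * of_real (cos (1 * u)) * of_real (cos (x / u))) has_integral integral {a..1} (H1_integrand z x)) {1..1/a}"
    by (rule has_integral_eq[rotated])
  then have "integral {a..1} (H1_integrand z x) = trunc_integral (- z) 1 x (1 / a)"
    unfolding trunc_integral_def by (simp add: integral_unique)
  moreover have "integral {1..b} (H1_integrand z x) = trunc_integral z x 1 b"
    unfolding trunc_integral_def H1_integrand_def ..
  moreover have "integral {a..b} (H1_integrand z x) = integral {a..1} (H1_integrand z x) + integral {1..b} (H1_integrand z x)"
    using assms by (intro Henstock_Kurzweil_Integration.integral_combine[symmetric] integrable_continuous_real cont) auto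
  ultimately show ?thesis by simp
qed

text \<open>Splitting at 1 makes each summand depend on one endpoint alone, so the joint limit along
  the product filter reduces to two separate limits.\<close>

lemma has_improper_integral_pos_H1_integrand:
  assumes "(trunc_integral (- z) 1 x \<longlongrightarrow> L1) at_top" "(trunc_integral z x 1 \<longlongrightarrow> L2) at_top"
  shows "has_improper_integral_pos (H1_integrand z x) (L1 + L2)"
  unfolding has_improper_integral_pos_def
proof (intro conjI allI impI)
  show "H1_integrand z x integrable_on {a..b}" if "0 < a" "a \<le> b" for a b
    unfolding H1_integrand_def using that
    by (intro integrable_continuous_real continuous_intros) auto
  have "((\<lambda>a. trunc_integral (- z) 1 x (1 / a)) \<longlongrightarrow> L1) (at_right 0)"
    using filterlim_compose[OF assms(1) filterlim_inverse_at_top_right] by (simp add: divide_inverse)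
  then have "((\<lambda>p. trunc_integral (- z) 1 x (1 / fst p) + trunc_integral z x 1 (snd p)) \<longlongrightarrow> L1 + L2)
               (at_right 0 \<times>\<^sub>F at_top)"
    by (intro tendsto_add filterlim_compose[OF _ filterlim_fst] filterlim_compose[OF _ filterlim_snd] assms(2))
       (assumption | rule filterlim_fst filterlim_snd assms)+
  moreover have "\<forall>\<^sub>F p in at_right 0 \<times>\<^sub>F at_top.
      trunc_integral (- z) 1 x (1 / fst p) + trunc_integral z x 1 (snd p) = (case p of (a, b) \<Rightarrow> integral {a..b} (H1_integrand z x))"
  proof (rule eventually_prod_filter[THEN iffD2], intro exI conjI allI impI)
    show "\<forall>\<^sub>F a::real in at_right 0. 0 < a \<and> a \<le> 1"
      by (intro eventually_conj eventually_at_right_less)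
         (auto simp: eventually_at_right_field intro: exI[of _ 1])
    show "\<forall>\<^sub>F b::real in at_top. 1 \<le> b" by (rule eventually_ge_at_top)
  qed (simp add: integral_H1_integrand)
  ultimately show "((\<lambda>(a, b). integral {a..b} (H1_integrand z x)) \<longlongrightarrow> L1 + L2) (at_right 0 \<times>\<^sub>F at_top)"
    by (rule Lim_transform_eventually)
qed

lemma H1_eqI:
  assumes "has_improper_integral_pos (H1_integrand z x) L"
  shows "H1 z x = L"
  unfolding H1_def
proof (rule the_equality)
  show "has_improper_integral_pos (H1_integrand z x) L" by (rule assms)
  fix L' assume "has_improper_integral_pos (H1_integrand z x) L'"
  moreover have "at_right (0::real) \<times>\<^sub>F (at_top :: real filter) \<noteq> bot"
    by (simp add: prod_filter_eq_bot trivial_limit_at_right_real)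
  ultimately show "L' = L"
    using assms tendsto_unique unfolding has_improper_integral_pos_def by blast
qed

section \<open>The double sum shared by the two halves\<close>

definition cos_coeff_at :: "real \<Rightarrow> nat \<Rightarrow> complex" where
  "cos_coeff_at y k = (-1) ^ k * of_real (y ^ (2 * k)) / fact (2 * k)"

lemma norm_cos_coeff_at: "norm (cos_coeff_at y k) = \<bar>y\<bar> ^ (2 * k) / fact (2 * k)"
  by (simp add: cos_coeff_at_def norm_mult norm_divide norm_power power_abs)

lemma abs_summable_cos_coeff_products:
  assumes z: "\<bar>Re z\<bar> < 1" "z \<noteq> 0"
  shows "(\<lambda>(k, m). cos_coeff_at y k * cos_coeff_at x m / (z - of_nat (2 * k) + of_nat (2 * m)))
            summable_on (UNIV :: (nat \<times> nat) set)" (is "?f summable_on _")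
proof -
  \<comment> \<open>The denominators stay away from 0: on the diagonal they equal \<open>z\<close>,
    and off it the real part has modulus at least 2 - |Re z| > 1.\<close>
  define \<delta> where "\<delta> = min (norm z) 1"
  have \<delta>: "\<delta> > 0" using z by (simp add: \<delta>_def)
  have \<delta>_le: "\<delta> \<le> norm (z - of_nat (2 * k) + of_nat (2 * m))" for k m :: nat
  proof (cases "k = m")
    case False
    then have "1 \<le> \<bar>real m - real k\<bar>"
      by (cases k m rule: linorder_cases) auto
    then have "1 \<le> \<bar>Re z + 2 * (real m - real k)\<bar>"
      using z(1) abs_triangle_ineq2[of "2 * (real m - real k)" "- Re z"] by (simp add: abs_mult)
    also have "\<dots> = \<bar>Re (z - of_nat (2 * k) + of_nat (2 * m))\<bar>"
      by (simp add: algebra_simps)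
    also have "\<dots> \<le> norm (z - of_nat (2 * k) + of_nat (2 * m))"
      by (rule abs_Re_le_cmod)
    finally show ?thesis by (simp add: \<delta>_def)
  qed (simp add: \<delta>_def)
  let ?M = "\<lambda>y k. \<bar>y\<bar> ^ (2 * k) / fact (2 * k) :: real"
  have M: "?M y summable_on UNIV" for y
    by (subst summable_on_UNIV_nonneg_real_iff) (auto simp: summable_even_exp)
  have "(\<lambda>(k, m). ?M y k * ?M x m / \<delta>) summable_on UNIV \<times> UNIV"
  proof (rule summable_on_SigmaI)
    show "((\<lambda>m. case (k, m) of (k, m) \<Rightarrow> ?M y k * ?M x m / \<delta>) has_sum ?M y k * (\<Sum>\<^sub>\<infinity>m. ?M x m) / \<delta>) UNIV" for k
      unfolding prod.case divide_inverse[of _ \<delta>]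
      by (intro has_sum_cmult_left has_sum_cmult_right has_sum_infsum M)
    show "(\<lambda>k. ?M y k * (\<Sum>\<^sub>\<infinity>m. ?M x m) / \<delta>) summable_on UNIV"
      unfolding divide_inverse[of _ \<delta>] by (intro summable_on_cmult_left M)
  qed (use \<delta> in auto)
  then have "(\<lambda>(k, m). ?M y k * ?M x m / \<delta>) summable_on UNIV" by simp
  moreover have "norm (case p of (k, m) \<Rightarrow> cos_coeff_at y k * cos_coeff_at x m / (z - of_nat (2 * k) + of_nat (2 * m)))
          \<le> (case p of (k, m) \<Rightarrow> ?M y k * ?M x m / \<delta>)" for p
  proof (cases p)
    case (Pair k m)
    have "?M y k * ?M x m / norm (z - of_nat (2 * k) + of_nat (2 * m)) \<le> ?M y k * ?M x m / \<delta>"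
      by (rule divide_left_mono[OF \<delta>_le]) (use \<delta> \<delta>_le[of k m] in \<open>auto intro!: mult_pos_pos\<close>)
    then show ?thesis
      unfolding Pair prod.case norm_divide norm_mult norm_cos_coeff_at .
  qed
  ultimately have "(\<lambda>p. norm (?f p)) summable_on UNIV"
    by (rule Infinite_Sum.abs_summable_on_comparison_test')
  then show ?thesis by (rule abs_summable_summable)
qed

lemma sin_pi_times_not_0:
  assumes "z \<notin> \<int>"
  shows "sin (of_real pi * z :: complex) \<noteq> 0"
proof
  assume "sin (of_real pi * z) = 0"
  then obtain n where "of_real pi * z = of_real (of_int n * pi)"
    by (auto simp: sin_eq_0)
  then have "z = of_int n" by simp
  with assms show False by auto
qed

lemma sums_infsum:
  fixes f :: "nat \<Rightarrow> 'a :: {topological_comm_monoid_add, t2_space}"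
  assumes "f summable_on UNIV"
  shows "f sums infsum f UNIV"
  using assms by (intro has_sum_imp_sums has_sum_infsum)

text \<open>For q > 0 this is q^(-\<nu>/2) times the mean of I_\<nu> and J_\<nu> at 2 sqrt q:
  averaging retains the terms of even index.\<close>

definition even_Bessel_series :: "complex \<Rightarrow> real \<Rightarrow> complex" where
  "even_Bessel_series \<nu> q = (\<Sum>k. rGamma (\<nu> + of_nat (2 * k) + 1) / fact (2 * k) * of_real q ^ (2 * k))"

text \<open>Formally the integral of t^(z-1) cos(x t) cos(y / t) over (0, 1), with both cosines
  expanded and each power integrated as if it converged at 0.\<close>

definition cos_cos_double_sum :: "complex \<Rightarrow> real \<Rightarrow> real \<Rightarrow> complex" where
  "cos_cos_double_sum z x y = (\<Sum>\<^sub>\<infinity>k. \<Sum>\<^sub>\<infinity>m. cos_coeff_at y k * cos_coeff_at x m / (z - of_nat (2 * k) + of_nat (2 * m)))"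

text \<open>Exchanging the frequencies transposes the indices, and negating \<open>z\<close> then
  flips the sign of every denominator. Absolute summability permits the change of summation order;
  this antisymmetry makes the two halves cancel.\<close>

lemma cos_cos_double_sum_uminus:
  assumes z: "\<bar>Re z\<bar> < 1" "z \<noteq> 0"
  shows "cos_cos_double_sum (- z) y x = - cos_cos_double_sum z x y"
proof -
  have "cos_cos_double_sum (- z) y x = (\<Sum>\<^sub>\<infinity>m. \<Sum>\<^sub>\<infinity>k. cos_coeff_at x k * cos_coeff_at y m / (- z - of_nat (2 * k) + of_nat (2 * m)))"
    unfolding cos_cos_double_sum_def
    by (rule infsum_swap_banach) (use abs_summable_cos_coeff_products[of "- z" x y] z in auto)
  also have "\<dots> = (\<Sum>\<^sub>\<infinity>m. \<Sum>\<^sub>\<infinity>k. - (cos_coeff_at y m * cos_coeff_at x k / (z - of_nat (2 * m) + of_nat (2 * k))))"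
  proof (intro infsum_cong)
    fix m k :: nat
    have "- z - of_nat (2 * k) + of_nat (2 * m) = - (z - of_nat (2 * m) + of_nat (2 * k))"
      by simp
    then show "cos_coeff_at x k * cos_coeff_at y m / (- z - of_nat (2 * k) + of_nat (2 * m)) =
      - (cos_coeff_at y m * cos_coeff_at x k / (z - of_nat (2 * m) + of_nat (2 * k)))"
      by (simp only: divide_minus_right mult.commute)
  qed
  also have "\<dots> = - cos_cos_double_sum z x y"
    unfolding cos_cos_double_sum_def by (simp only: infsum_uminus)
  finally show ?thesis .
qed

lemma tendsto_trunc_integral_closed_form:
  assumes z: "\<bar>Re z\<bar> < 1" "z \<noteq> 0" and x: "x > 0"
  shows "(trunc_integral z x y \<longlongrightarrow>
     of_real pi / (2 * sin (of_real pi * z / 2)) * of_real x powr (- z) * even_Bessel_series (- z) (x * y)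
       - cos_cos_double_sum z x y) at_top"
proof -
  define T where "T = (\<lambda>k. (lower_gamma_series (z - of_nat (2 * k)) (\<i> * of_real x)
       + lower_gamma_series (z - of_nat (2 * k)) (- \<i> * of_real x)) / 2)"
  define P where "P = of_real pi / (2 * sin (of_real pi * z / 2)) * of_real x powr (- z)"
  note summ = abs_summable_cos_coeff_products[OF z, of y x]
  have "(\<lambda>k. \<Sum>\<^sub>\<infinity>m. cos_coeff_at y k * cos_coeff_at x m / (z - of_nat (2 * k) + of_nat (2 * m))) sums cos_cos_double_sum z x y"
    unfolding cos_cos_double_sum_def
    by (rule sums_infsum) (use summable_on_Sigma_banach[of "\<lambda>k m. cos_coeff_at y k * cos_coeff_at x m / (z - of_nat (2 * k) + of_nat (2 * m))" UNIV "\<lambda>_. UNIV"] summ in simp)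
  moreover have "(\<Sum>\<^sub>\<infinity>m. cos_coeff_at y k * cos_coeff_at x m / (z - of_nat (2 * k) + of_nat (2 * m))) = cos_coeff_at y k * T k" for k
  proof -
    have "(\<lambda>m. cos_coeff_at y k * (cos_coeff_at x m / (z - of_nat (2 * k) + of_nat (2 * m)))) sums (cos_coeff_at y k * T k)"
      using lower_gamma_series_even_sums[of x "z - of_nat (2 * k)"]
      by (intro sums_mult) (simp add: T_def cos_coeff_at_def)
    moreover have "(\<lambda>m. cos_coeff_at y k * cos_coeff_at x m / (z - of_nat (2 * k) + of_nat (2 * m))) summable_on UNIV"
      using summable_on_SigmaD1[of "\<lambda>k m. cos_coeff_at y k * cos_coeff_at x m / (z - of_nat (2 * k) + of_nat (2 * m))" UNIV "\<lambda>_. UNIV" k] summ by simp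
    ultimately show ?thesis
      using sums_infsum sums_unique2 by (metis (mono_tags, lifting) sums_cong times_divide_eq_right)
  qed
  ultimately have D: "(\<lambda>k. cos_coeff_at y k * T k) sums cos_cos_double_sum z x y"
    by simp
  have double: "sin (of_real pi * z) = 2 * sin (of_real pi * z / 2) * cos (of_real pi * z / 2)"
    using sin_double[of "of_real pi * z / 2"] by simp
  have sinz: "sin (of_real pi * z) \<noteq> 0"
    by (intro sin_pi_times_not_0 strip_nonzero_not_Ints z)
  have P: "P \<noteq> 0"
    using x sinz by (auto simp: P_def double)
  \<comment> \<open>Reflection turns Gamma(z - 2k) into pi / sin(pi z) times a reciprocal Gamma
    value. The sign (-1)^k from cos(pi (z - 2k) / 2) cancels that of the cosine coefficient, and
    halving the angle of sin(pi z) leaves the common factor \<open>P\<close>.\<close>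
  have main: "cos_coeff_at y k * cos_tail (z - of_nat (2 * k)) x =
      P * (rGamma (- z + of_nat (2 * k) + 1) / fact (2 * k) * of_real (x * y) ^ (2 * k)) - cos_coeff_at y k * T k" for k
  proof -
    have per: "sin (of_real pi * (z - of_nat (2 * k))) = sin (of_real pi * z)"
    proof -
      have "of_real pi * (z - of_nat (2 * k)) = of_real pi * z - of_nat (2 * k) * of_real pi"
        by (simp add: algebra_simps)
      moreover have "sin (of_nat (2 * k) * of_real pi :: complex) = 0"
        by (simp only: sin_npi_complex')
      ultimately show ?thesis by (simp only: sin_diff cos_npi_complex') simp
    qed
    have co: "cos (of_real pi * (z - of_nat (2 * k)) / 2) = (-1) ^ k * cos (of_real pi * z / 2)"
    proof -
      have "of_real pi * (z - of_nat (2 * k)) / 2 = of_real pi * z / 2 - of_nat k * of_real pi"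
        by (simp add: field_simps)
      then show ?thesis by (simp only: cos_diff cos_npi_complex' sin_npi_complex') simp
    qed
    have ga: "Gamma (z - of_nat (2 * k)) = of_real pi / sin (of_real pi * z) * rGamma (- z + of_nat (2 * k) + 1)"
    proof -
      have "rGamma (z - of_nat (2 * k)) * rGamma (1 - (z - of_nat (2 * k))) = sin (of_real pi * z) / of_real pi"
        using rGamma_reflection_complex[of "z - of_nat (2 * k)"] per by simp
      moreover have "1 - (z - of_nat (2 * k)) = - z + of_nat (2 * k) + 1" by simp
      ultimately have "rGamma (z - of_nat (2 * k)) * rGamma (- z + of_nat (2 * k) + 1) = sin (of_real pi * z) / of_real pi"
        by (simp only:)
      moreover from this sinz have "rGamma (z - of_nat (2 * k)) \<noteq> 0" by auto
      ultimately show ?thesis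
        using sinz by (simp add: Gamma_def field_simps)
    qed
    have po: "of_real x powr (- (z - of_nat (2 * k))) = of_real x powr (- z) * (of_real x ^ (2 * k) :: complex)"
    proof -
      have "of_real x powr of_nat (2 * k) = (of_real x ^ (2 * k) :: complex)"
        using x by (intro powr_nat') auto
      moreover have "- (z - of_nat (2 * k)) = - z + of_nat (2 * k)" by simp
      ultimately show ?thesis by (simp only: powr_add)
    qed
    have "cos_coeff_at y k * (Gamma (z - of_nat (2 * k)) * of_real x powr (- (z - of_nat (2 * k))) * cos (of_real pi * (z - of_nat (2 * k)) / 2))
       = P * (rGamma (- z + of_nat (2 * k) + 1) / fact (2 * k) * of_real (x * y) ^ (2 * k))"
      unfolding ga po co double cos_coeff_at_def P_def using sinz unfolding double
      by (simp add: power_mult_distrib power_mult[symmetric] power_add[symmetric] field_simps)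
    then show ?thesis
      by (simp add: cos_tail_def T_def right_diff_distrib)
  qed
  note tt = tendsto_trunc_integral[OF z x, of y, folded cos_coeff_at_def]
  have "(\<lambda>k. cos_coeff_at y k * cos_tail (z - of_nat (2 * k)) x) sums (\<Sum>k. cos_coeff_at y k * cos_tail (z - of_nat (2 * k)) x)"
    using summable_norm_cancel[OF tt(2)] by (rule summable_sums)
  \<comment> \<open>Convergence of the even Bessel series comes for free: the sum of two convergent
    series is \<open>P\<close> times it, and \<open>P\<close> is nonzero.\<close>
  from sums_add[OF this D]
  have "(\<lambda>k. P * (rGamma (- z + of_nat (2 * k) + 1) / fact (2 * k) * of_real (x * y) ^ (2 * k)))
     sums ((\<Sum>k. cos_coeff_at y k * cos_tail (z - of_nat (2 * k)) x) + cos_cos_double_sum z x y)"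
    by (simp only: main diff_add_cancel)
  from sums_divide[OF this, of P]
  have "(\<lambda>k. rGamma (- z + of_nat (2 * k) + 1) / fact (2 * k) * of_real (x * y) ^ (2 * k))
     sums (((\<Sum>k. cos_coeff_at y k * cos_tail (z - of_nat (2 * k)) x) + cos_cos_double_sum z x y) / P)"
    by (simp only: nonzero_mult_div_cancel_left[OF P])
  then have "even_Bessel_series (- z) (x * y) = ((\<Sum>k. cos_coeff_at y k * cos_tail (z - of_nat (2 * k)) x) + cos_cos_double_sum z x y) / P"
    unfolding even_Bessel_series_def by (rule sums_unique[symmetric])
  then have "P * even_Bessel_series (- z) (x * y) - cos_cos_double_sum z x y = (\<Sum>k. cos_coeff_at y k * cos_tail (z - of_nat (2 * k)) x)"
    using P by (simp add: field_simps)
  then show ?thesis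
    using tt(1) by (simp only: P_def)
qed

section \<open>Bessel functions as functions of the order\<close>

text \<open>From the second term on, norms decrease, since rGamma(s) = s rGamma(s + 1) and |s| \<ge>
  1. The bound is uniform in \<open>k\<close> and continuous in \<open>\<nu>\<close>, as the M-test
  over the order requires.\<close>

lemma norm_rGamma_shift_le:
  assumes "Re \<nu> > -1"
  shows "norm (rGamma (\<nu> + of_nat k + 1)) \<le> norm (rGamma (\<nu> + 1)) + norm (rGamma (\<nu> + 2))"
proof -
  have *: "norm (rGamma (\<nu> + of_nat k + 2)) \<le> norm (rGamma (\<nu> + 2))" for k
  proof (induction k)
    case (Suc k)
    have "1 \<le> Re (\<nu> + of_nat k + 2)" using assms by simp
    also have "\<dots> \<le> norm (\<nu> + of_nat k + 2)" by (rule complex_Re_le_cmod)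
    finally have "1 * norm (rGamma (\<nu> + of_nat k + 2 + 1)) \<le> norm (\<nu> + of_nat k + 2) * norm (rGamma (\<nu> + of_nat k + 2 + 1))"
      by (intro mult_right_mono) auto
    also have "\<dots> = norm (rGamma (\<nu> + of_nat k + 2))"
      by (simp only: norm_mult[symmetric] rGamma_plus1)
    finally show ?case using Suc by (simp add: algebra_simps)
  qed simp
  show ?thesis
  proof (cases k)
    case (Suc j)
    have "norm (rGamma (\<nu> + of_nat k + 1)) \<le> norm (rGamma (\<nu> + 2))"
      using *[of j] Suc by (simp add: algebra_simps)
    then show ?thesis using norm_ge_zero[of "rGamma (\<nu> + 1)"] by linarith
  qed simp
qed

text \<open>The power-free part of I_\<nu>(2q) for \<open>e = 1\<close> and of J_\<nu>(2q) for
  \<open>e = -1\<close>, so that both are treated at once.\<close>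

definition Bessel_series :: "complex \<Rightarrow> real \<Rightarrow> complex \<Rightarrow> complex" where
  "Bessel_series e q \<nu> = (\<Sum>k. e ^ k * rGamma (\<nu> + of_nat k + 1) / fact k * of_real q ^ (2 * k))"

lemma summable_Bessel_series:
  assumes "norm e = 1" "Re \<nu> > -1"
  shows "summable (\<lambda>k. e ^ k * rGamma (\<nu> + of_nat k + 1) / fact k * of_real q ^ (2 * k) :: complex)"
proof (rule summable_comparison_test)
  let ?C = "norm (rGamma (\<nu> + 1)) + norm (rGamma (\<nu> + 2))"
  have "summable (\<lambda>k. (q\<^sup>2) ^ k / fact k)"
    using summable_exp[of "q\<^sup>2"] by (simp add: divide_inverse mult.commute)
  then show "summable (\<lambda>k. ?C * ((q\<^sup>2) ^ k / fact k))"
    by (rule summable_mult)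
  have "norm (e ^ k * rGamma (\<nu> + of_nat k + 1) / fact k * of_real q ^ (2 * k)) \<le> ?C * ((q\<^sup>2) ^ k / fact k)" for k
  proof -
    have "norm (e ^ k * rGamma (\<nu> + of_nat k + 1) / fact k * of_real q ^ (2 * k)) =
       norm (rGamma (\<nu> + of_nat k + 1)) * ((q\<^sup>2) ^ k / fact k)"
      using assms(1) by (simp add: norm_mult norm_divide norm_power power_mult)
    also have "\<dots> \<le> ?C * ((q\<^sup>2) ^ k / fact k)"
      by (intro mult_right_mono norm_rGamma_shift_le assms) auto
    finally show ?thesis .
  qed
  then show "\<exists>N. \<forall>k\<ge>N. norm (e ^ k * rGamma (\<nu> + of_nat k + 1) / fact k * of_real q ^ (2 * k)) \<le> ?C * ((q\<^sup>2) ^ k / fact k)"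
    by blast
qed

lemma Bessel_series_sum:
  assumes "Re \<nu> > -1"
  shows "Bessel_series 1 q \<nu> + Bessel_series (-1) q \<nu> = 2 * even_Bessel_series \<nu> (q\<^sup>2)"
proof -
  define f where "f = (\<lambda>k. 1 ^ k * rGamma (\<nu> + of_nat k + 1) / fact k * of_real q ^ (2 * k) +
        (-1) ^ k * rGamma (\<nu> + of_nat k + 1) / fact k * of_real q ^ (2 * k))"
  have f: "f sums (Bessel_series 1 q \<nu> + Bessel_series (-1) q \<nu>)"
    unfolding f_def Bessel_series_def
    by (intro sums_add summable_sums summable_Bessel_series assms) auto
  have "f k = 0" if "k \<notin> range (\<lambda>m. 2 * m)" for k
  proof -
    from that have "odd k" by (auto elim!: evenE)
    then show ?thesis by (simp add: f_def)
  qed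
  with f have "(\<lambda>m. f (2 * m)) sums (Bessel_series 1 q \<nu> + Bessel_series (-1) q \<nu>)"
    by (subst sums_mono_reindex) (auto simp: strict_mono_def)
  moreover have "f (2 * m) = 2 * (rGamma (\<nu> + of_nat (2 * m) + 1) / fact (2 * m) * of_real (q\<^sup>2) ^ (2 * m))" for m
    by (simp add: f_def flip: power_mult)
  ultimately have "(\<lambda>m. 2 * (rGamma (\<nu> + of_nat (2 * m) + 1) / fact (2 * m) * of_real (q\<^sup>2) ^ (2 * m)))
      sums (Bessel_series 1 q \<nu> + Bessel_series (-1) q \<nu>)"
    by simp
  from sums_divide[OF this, of 2] show ?thesis
    unfolding even_Bessel_series_def by (simp add: sums_iff field_simps)
qed

text \<open>Each term is entire in the order. Compactness of the closed disc turns the pointwise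
  bound on the reciprocal Gamma values into a uniform one, and uniform limits of holomorphic
  functions are holomorphic.\<close>

lemma holomorphic_Bessel_series:
  assumes "norm e = 1"
  shows "Bessel_series e q holomorphic_on ball 0 (1 / 2)"
proof -
  let ?f = "\<lambda>k \<nu>. e ^ k * rGamma (\<nu> + of_nat k + 1) / fact k * of_real q ^ (2 * k)"
  let ?g = "\<lambda>\<nu>::complex. norm (rGamma (\<nu> + 1)) + norm (rGamma (\<nu> + 2))"
  have "compact (?g ` cball 0 (1 / 2))"
    by (intro compact_continuous_image continuous_intros continuous_on_compose2[OF continuous_on_rGamma[of UNIV]]) auto
  then have "bdd_above (?g ` cball 0 (1 / 2))"
    by (intro bounded_imp_bdd_above compact_imp_bounded)
  then obtain C where C: "\<And>\<nu>. \<nu> \<in> cball 0 (1 / 2) \<Longrightarrow> ?g \<nu> \<le> C"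
    unfolding bdd_above_def by blast
  have ul: "uniform_limit (cball 0 (1 / 2)) (\<lambda>n \<nu>. \<Sum>k<n. ?f k \<nu>) (\<lambda>\<nu>. \<Sum>k. ?f k \<nu>) sequentially"
  proof (rule Weierstrass_m_test)
    have "summable (\<lambda>k. (q\<^sup>2) ^ k / fact k)"
      using summable_exp[of "q\<^sup>2"] by (simp add: divide_inverse mult.commute)
    then show "summable (\<lambda>k. C * ((q\<^sup>2) ^ k / fact k))"
      by (rule summable_mult)
    fix k and \<nu> :: complex assume \<nu>: "\<nu> \<in> cball 0 (1 / 2)"
    then have Re: "Re \<nu> > -1" using abs_Re_le_cmod[of \<nu>] by simp
    have "norm (?f k \<nu>) = norm (rGamma (\<nu> + of_nat k + 1)) * ((q\<^sup>2) ^ k / fact k)"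
      using assms by (simp add: norm_mult norm_divide norm_power power_mult)
    also have "\<dots> \<le> C * ((q\<^sup>2) ^ k / fact k)"
      using norm_rGamma_shift_le[OF Re, of k] C[OF \<nu>] by (intro mult_right_mono) auto
    finally show "norm (?f k \<nu>) \<le> C * ((q\<^sup>2) ^ k / fact k)" .
  qed
  have ev: "\<forall>\<^sub>F n in sequentially. continuous_on (cball 0 (1 / 2)) (\<lambda>\<nu>. \<Sum>k<n. ?f k \<nu>) \<and>
        (\<lambda>\<nu>. \<Sum>k<n. ?f k \<nu>) holomorphic_on ball 0 (1 / 2)"
    by (intro always_eventually allI conjI continuous_intros holomorphic_intros
          continuous_on_compose2[OF continuous_on_rGamma[of UNIV]]) auto
  have "(\<lambda>\<nu>. \<Sum>k. ?f k \<nu>) holomorphic_on ball 0 (1 / 2)"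
    by (rule holomorphic_uniform_limit[OF ev ul sequentially_bot])
  then show ?thesis
    by (simp only: Bessel_series_def[abs_def])
qed

lemma of_real_sqrt_powr:
  assumes "x > 0"
  shows "of_real (sqrt x) powr \<nu> = (of_real x powr (\<nu> / 2) :: complex)"
  using assms by (simp add: powr_def ln_sqrt Ln_of_real del: of_real_sqrt)

lemma bessel_I_conv_Bessel_series:
  "bessel_I \<nu> (of_real (2 * q)) = of_real q powr \<nu> * Bessel_series 1 q \<nu>"
  by (simp add: bessel_I_def Bessel_series_def)

lemma bessel_J_conv_Bessel_series:
  "bessel_J \<nu> (of_real (2 * q)) = of_real q powr \<nu> * Bessel_series (-1) q \<nu>"
  by (simp add: bessel_J_def Bessel_series_def)

lemma holomorphic_bessel_IJ_order:
  assumes "q > 0"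
  shows "(\<lambda>\<nu>. bessel_I \<nu> (of_real (2 * q))) holomorphic_on ball 0 (1 / 2)"
    and "(\<lambda>\<nu>. bessel_J \<nu> (of_real (2 * q))) holomorphic_on ball 0 (1 / 2)"
  unfolding bessel_I_conv_Bessel_series bessel_J_conv_Bessel_series
  using assms by (auto intro!: holomorphic_intros holomorphic_Bessel_series)

lemma holomorphic_on_ball_uminus:
  fixes f :: "complex \<Rightarrow> complex"
  assumes "f holomorphic_on ball 0 r"
  shows "(\<lambda>\<mu>. f (- \<mu>)) holomorphic_on ball 0 r"
proof -
  have "(uminus :: complex \<Rightarrow> complex) holomorphic_on ball 0 r"
    by (rule holomorphic_on_minus[OF holomorphic_on_ident])
  from holomorphic_on_compose_gen[OF this assms] show ?thesis by (auto simp: o_def image_subset_iff)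
qed

section \<open>Removable singularities of the second-kind functions at order 0\<close>

text \<open>Numerator and denominator both vanish at 0; dividing each by \<mu> gives difference
  quotients, and the limit is g'(0) / pi.\<close>

lemma quotient_sin_limit_at_0:
  fixes g :: "complex \<Rightarrow> complex"
  assumes "g holomorphic_on ball 0 r" "r > 0" "g 0 = 0"
  obtains l where "((\<lambda>\<mu>. g \<mu> / sin (of_real pi * \<mu>)) \<longlongrightarrow> l) (at 0)"
proof -
  have g: "((\<lambda>\<mu>. g \<mu> / \<mu>) \<longlongrightarrow> deriv g 0) (at 0)"
    using holomorphic_derivI[OF assms(1), of 0 UNIV] assms by (simp add: DERIV_def)
  have "((\<lambda>\<mu>. sin (of_real pi * \<mu>)) has_field_derivative of_real pi) (at (0 :: complex))"
    by (auto intro!: derivative_eq_intros)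
  then have s: "((\<lambda>\<mu>. sin (of_real pi * \<mu>) / \<mu>) \<longlongrightarrow> of_real pi) (at (0 :: complex))"
    by (simp add: DERIV_def)
  have "((\<lambda>\<mu>. (g \<mu> / \<mu>) / (sin (of_real pi * \<mu>) / \<mu>)) \<longlongrightarrow> deriv g 0 / of_real pi) (at 0)"
    by (intro tendsto_divide g s) auto
  moreover have "\<forall>\<^sub>F \<mu> in at 0. (g \<mu> / \<mu>) / (sin (of_real pi * \<mu>) / \<mu>) = g \<mu> / sin (of_real pi * \<mu>)"
    by (auto simp: eventually_at_filter)
  ultimately show ?thesis
    by (intro that) (rule Lim_transform_eventually)
qed

lemma eventually_not_Ints_at_0: "\<forall>\<^sub>F \<mu> in at (0::complex). \<mu> \<notin> \<int>"
  unfolding eventually_at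
proof (intro exI[of _ 1] conjI ballI impI)
  fix \<mu> :: complex assume "\<mu> \<noteq> 0 \<and> dist \<mu> 0 < 1"
  then show "\<mu> \<notin> \<int>"
    using abs_Re_le_cmod[of \<mu>] by (intro strip_nonzero_not_Ints) auto
qed auto

lemma bessel_Y_tendsto_order_0:
  assumes "q > 0"
  shows "((\<lambda>\<mu>. bessel_Y \<mu> (of_real (2 * q))) \<longlongrightarrow> bessel_Y 0 (of_real (2 * q))) (at 0)"
proof -
  let ?w = "of_real (2 * q) :: complex"
  let ?Q = "\<lambda>\<mu>. (bessel_J \<mu> ?w * cos (of_real pi * \<mu>) - bessel_J (- \<mu>) ?w) / sin (of_real pi * \<mu>)"
  have "(\<lambda>\<mu>. bessel_J (- \<mu>) ?w) holomorphic_on ball 0 (1 / 2)"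
    by (intro holomorphic_on_ball_uminus holomorphic_bessel_IJ_order assms)
  then have "(\<lambda>\<mu>. bessel_J \<mu> ?w * cos (of_real pi * \<mu>) - bessel_J (- \<mu>) ?w) holomorphic_on ball 0 (1 / 2)"
    by (intro holomorphic_intros holomorphic_bessel_IJ_order assms)
  then obtain l where l: "(?Q \<longlongrightarrow> l) (at 0)"
    by (rule quotient_sin_limit_at_0) auto
  \<comment> \<open>Order 0 falls under the \<open>Lim\<close> branch of the definition, which has
    its intended value because the limit \<open>l\<close> exists.\<close>
  then have "bessel_Y 0 ?w = l"
    unfolding bessel_Y_def Let_def by (simp add: tendsto_Lim)
  moreover have "\<forall>\<^sub>F \<mu> in at 0. ?Q \<mu> = bessel_Y \<mu> ?w"
    using eventually_not_Ints_at_0 by eventually_elim (simp add: bessel_Y_def)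
  moreover from l this have "((\<lambda>\<mu>. bessel_Y \<mu> ?w) \<longlongrightarrow> l) (at 0)"
    by (rule Lim_transform_eventually)
  ultimately show ?thesis by simp
qed

lemma bessel_K_tendsto_order_0:
  assumes "q > 0"
  shows "((\<lambda>\<mu>. bessel_K \<mu> (of_real (2 * q))) \<longlongrightarrow> bessel_K 0 (of_real (2 * q))) (at 0)"
proof -
  let ?w = "of_real (2 * q) :: complex"
  let ?Q = "\<lambda>\<mu>. of_real pi / 2 * (bessel_I (- \<mu>) ?w - bessel_I \<mu> ?w) / sin (of_real pi * \<mu>)"
  have "(\<lambda>\<mu>. bessel_I (- \<mu>) ?w) holomorphic_on ball 0 (1 / 2)"
    by (intro holomorphic_on_ball_uminus holomorphic_bessel_IJ_order assms)
  then have "(\<lambda>\<mu>. of_real pi / 2 * (bessel_I (- \<mu>) ?w - bessel_I \<mu> ?w)) holomorphic_on ball 0 (1 / 2)"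
    by (intro holomorphic_intros holomorphic_bessel_IJ_order assms)
  then obtain l where l: "(?Q \<longlongrightarrow> l) (at 0)"
    by (rule quotient_sin_limit_at_0) auto
  then have "bessel_K 0 ?w = l"
    unfolding bessel_K_def Let_def by (simp add: tendsto_Lim)
  moreover have "\<forall>\<^sub>F \<mu> in at 0. ?Q \<mu> = bessel_K \<mu> ?w"
    using eventually_not_Ints_at_0 by eventually_elim (simp add: bessel_K_def)
  moreover from l this have "((\<lambda>\<mu>. bessel_K \<mu> ?w) \<longlongrightarrow> l) (at 0)"
    by (rule Lim_transform_eventually)
  ultimately show ?thesis by simp
qed

section \<open>The closed form\<close>

definition H1_closed_form :: "complex \<Rightarrow> real \<Rightarrow> complex" where
  "H1_closed_form z x = of_real pi / 2 * of_real x powr (- z / 2) *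
     (cos (of_real pi * z / 2) * bessel_M z (of_real (2 * sqrt x))
      - sin (of_real pi * z / 2) * bessel_J z (of_real (2 * sqrt x)))"

lemma H1_closed_form_tendsto_0:
  assumes "x > 0"
  shows "((\<lambda>z. H1_closed_form z x) \<longlongrightarrow> H1_closed_form 0 x) (at 0)"
proof -
  have q: "sqrt x > 0" using assms by simp
  have "isCont (\<lambda>\<nu>. bessel_J \<nu> (of_real (2 * sqrt x))) 0"
    by (rule continuous_on_interior[OF holomorphic_on_imp_continuous_on[OF holomorphic_bessel_IJ_order(2)[OF q]]]) simp
  then have "((\<lambda>\<nu>. bessel_J \<nu> (of_real (2 * sqrt x))) \<longlongrightarrow> bessel_J 0 (of_real (2 * sqrt x))) (at 0)"
    by (simp only: isCont_def)
  then show ?thesis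
    unfolding H1_closed_form_def bessel_M_def
    by (intro tendsto_intros bessel_K_tendsto_order_0 bessel_Y_tendsto_order_0 q) (use assms in auto)
qed

text \<open>With S and C the sine and cosine of pi z / 2, substituting cos(pi z) = 1 - 2 S^2 makes
  the S J_z contributions cancel. What remains are the sums I + J at orders -z and z, over 2 S, and
  these are even Bessel series.\<close>

lemma H1_closed_form_eq:
  assumes z: "\<bar>Re z\<bar> < 1" "z \<noteq> 0" and x: "x > 0"
  shows "H1_closed_form z x = of_real pi / (2 * sin (of_real pi * z / 2)) *
           (of_real x powr (- z) * even_Bessel_series (- z) x - even_Bessel_series z x)"
proof -
  have nonint: "z \<notin> \<int>" by (rule strip_nonzero_not_Ints[OF z])
  define S where "S = sin (of_real pi * z / 2)"
  define C where "C = cos (of_real pi * z / 2)"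
  define w :: complex where "w = of_real (2 * sqrt x)"
  have double: "sin (of_real pi * z) = 2 * S * C"
    using sin_double[of "of_real pi * z / 2"] by (simp add: S_def C_def)
  then have nz: "S \<noteq> 0" "C \<noteq> 0"
    using sin_pi_times_not_0[OF nonint] by auto
  have cosz: "cos (of_real pi * z) = 1 - 2 * S\<^sup>2"
    using cos_double_sin[of "of_real pi * z / 2"] by (simp add: S_def)
  have IJ: "bessel_I \<nu> w + bessel_J \<nu> w = 2 * of_real x powr (\<nu> / 2) * even_Bessel_series \<nu> x" if "Re \<nu> > -1" for \<nu>
  proof -
    have "bessel_I \<nu> w + bessel_J \<nu> w = of_real x powr (\<nu> / 2) * (Bessel_series 1 (sqrt x) \<nu> + Bessel_series (-1) (sqrt x) \<nu>)"
      unfolding w_def bessel_I_conv_Bessel_series bessel_J_conv_Bessel_series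
      by (simp only: of_real_sqrt_powr[OF x] distrib_left)
    then show ?thesis
      using x by (simp add: Bessel_series_sum[OF that])
  qed
  have "C * bessel_M z w - S * bessel_J z w =
    (bessel_I (- z) w + bessel_J (- z) w - (bessel_I z w + bessel_J z w)) / (2 * S)"
  proof -
    have KY: "bessel_K z w = of_real pi / 2 * (bessel_I (- z) w - bessel_I z w) / (2 * S * C)"
      "bessel_Y z w = (bessel_J z w * (1 - 2 * S\<^sup>2) - bessel_J (- z) w) / (2 * S * C)"
      using nonint by (simp_all only: bessel_K_def bessel_Y_def Let_def if_False double cosz)
    show ?thesis
      using nz unfolding bessel_M_def KY by (simp add: field_simps power2_eq_square)
  qed
  also have "\<dots> = (of_real x powr (- z / 2) * even_Bessel_series (- z) x - of_real x powr (z / 2) * even_Bessel_series z x) / S"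
    using z nz by (simp add: IJ field_simps)
  finally have "H1_closed_form z x = of_real pi / 2 * of_real x powr (- z / 2) *
      ((of_real x powr (- z / 2) * even_Bessel_series (- z) x - of_real x powr (z / 2) * even_Bessel_series z x) / S)"
    by (simp only: H1_closed_form_def S_def C_def w_def)
  also have "\<dots> = of_real pi / (2 * S) * (of_real x powr (- z / 2) * of_real x powr (- z / 2) * even_Bessel_series (- z) x
      - of_real x powr (- z / 2) * of_real x powr (z / 2) * even_Bessel_series z x)"
    using nz by (simp add: field_simps)
  also have "of_real x powr (- z / 2) * of_real x powr (- z / 2) = (of_real x powr (- z) :: complex)"
    by (simp flip: powr_add)
  also have "of_real x powr (- z / 2) * of_real x powr (z / 2) = (1 :: complex)"
    using x by (simp flip: powr_add)
  finally show ?thesis by (simp add: S_def)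
qed

section \<open>Evaluation for nonzero and for zero z\<close>

lemma has_improper_integral_H1_closed_form_nonzero:
  assumes z: "\<bar>Re z\<bar> < 1" "z \<noteq> 0" and x: "x > 0"
  shows "has_improper_integral_pos (H1_integrand z x) (H1_closed_form z x)"
proof -
  let ?A = "\<lambda>z x y. of_real pi / (2 * sin (of_real pi * z / 2)) * of_real x powr (- z) * even_Bessel_series (- z) (x * y)
       - cos_cos_double_sum z x y"
  have "has_improper_integral_pos (H1_integrand z x) (?A (- z) 1 x + ?A z x 1)"
    using z x by (intro has_improper_integral_pos_H1_integrand tendsto_trunc_integral_closed_form) auto
  \<comment> \<open>The double sums cancel by antisymmetry. In the first half the frequency 1 has
    trivial power and the sine is odd, which produces the term with order \<open>z\<close> and a
    minus sign.\<close>
  moreover have "?A (- z) 1 x + ?A z x 1 = H1_closed_form z x"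
    unfolding H1_closed_form_eq[OF z x] cos_cos_double_sum_uminus[OF z, of 1 x]
    by (simp add: algebra_simps diff_divide_distrib)
  ultimately show ?thesis by simp
qed

lemma has_improper_integral_H1_closed_form_0:
  assumes x: "x > 0"
  shows "has_improper_integral_pos (H1_integrand 0 x) (H1_closed_form 0 x)"
proof -
  obtain L1 where L1: "\<And>z. norm z \<le> 1 / 2 \<Longrightarrow> (trunc_integral z 1 x \<longlongrightarrow> L1 z) at_top" "isCont L1 0"
    using trunc_integral_limit_near_0[of 1 x] by auto
  obtain L2 where L2: "\<And>z. norm z \<le> 1 / 2 \<Longrightarrow> (trunc_integral z x 1 \<longlongrightarrow> L2 z) at_top" "isCont L2 0"
    using trunc_integral_limit_near_0[OF x, of 1] by auto
  have imp: "has_improper_integral_pos (H1_integrand z x) (L1 (- z) + L2 z)" if "norm z \<le> 1 / 2" for z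
    by (intro has_improper_integral_pos_H1_integrand L1 L2) (use that in auto)
  \<comment> \<open>Near 0 but off it, both expressions are values of the same improper integral and
    hence agree; since both sides are continuous at 0, the identity extends to z = 0.\<close>
  have "\<forall>\<^sub>F z in at 0. L1 (- z) + L2 z = H1_closed_form z x"
    unfolding eventually_at
  proof (intro exI[of _ "1 / 2"] conjI ballI impI)
    fix z :: complex assume z: "z \<noteq> 0 \<and> dist z 0 < 1 / 2"
    then have "has_improper_integral_pos (H1_integrand z x) (H1_closed_form z x)"
      using abs_Re_le_cmod[of z] x by (intro has_improper_integral_H1_closed_form_nonzero) auto
    moreover have "has_improper_integral_pos (H1_integrand z x) (L1 (- z) + L2 z)"
      using imp z by auto
    ultimately show "L1 (- z) + L2 z = H1_closed_form z x"
      using H1_eqI by metis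
  qed auto
  moreover have "((\<lambda>z. L1 (- z) + L2 z) \<longlongrightarrow> L1 (- 0) + L2 0) (at 0)"
  proof (intro tendsto_add)
    have "isCont (\<lambda>z. L1 (- z)) 0"
      by (rule isCont_o2) (use L1(2) in auto)
    then show "((\<lambda>z. L1 (- z)) \<longlongrightarrow> L1 (- 0)) (at 0)" by (simp only: isCont_def)
    show "(L2 \<longlongrightarrow> L2 0) (at 0)" using L2(2) by (simp only: isCont_def)
  qed
  ultimately have "((\<lambda>z. H1_closed_form z x) \<longlongrightarrow> L1 (- 0) + L2 0) (at 0)"
    by (simp add: Lim_transform_eventually)
  then have "L1 (- 0) + L2 0 = H1_closed_form 0 x"
    using H1_closed_form_tendsto_0[OF x] by (rule LIM_unique)
  with imp[of 0] show ?thesis by simp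
qed

theorem theorem4p9:
  fixes z :: complex and x :: real
  assumes "-1 < Re z" and "Re z < 1" and "x > 0"
  shows "has_improper_integral_pos (H1_integrand z x) (H1 z x) \<and>
         H1 z x = of_real pi / 2 * of_real x powr (- z / 2) *
           (cos (of_real pi * z / 2) * bessel_M z (of_real (2 * sqrt x))
            - sin (of_real pi * z / 2) * bessel_J z (of_real (2 * sqrt x)))"
proof -
  have "has_improper_integral_pos (H1_integrand z x) (H1_closed_form z x)"
    using assms has_improper_integral_H1_closed_form_nonzero[of z x] has_improper_integral_H1_closed_form_0[of x]
    by (cases "z = 0") auto
  moreover from this have "H1 z x = H1_closed_form z x"
    by (rule H1_eqI)
  ultimately show ?thesis
    by (simp only: H1_closed_form_def simp_thms)
qed

end
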